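(* Let $F : (0,\infty) \to \mathbb{R}$ and let $p$ and $d$ be positive integers with $p < d$. The following are equivalent. (1) $F$ preserves $\mathrm{TP}_p$ entrywise on symmetric $d \times d$ matrices. (2) $F$ preserves $\mathrm{TP}_p$ entrywise on $d \times d$ matrices. (3) $F$ preserves total positivity entrywise on $p \times p$ matrices. (4) The function $F$ satisfies: (a) if $p = 1$: $F(x) > 0$ for all $x > 0$; (b) if $p = 2$: $F(x) = c x^\alpha$ for some $c > 0$ and some $\alpha > 0$; (c) if $p = 3$: $F(x) = c x^\alpha$ for some $c > 0$ and some $\alpha \geq 1$; (d) if $p \geq 4$: $F(x) = cx$ for some $c > 0$. The same functions characterize the preservers of symmetric $\mathrm{TP}_p$ kernels: if $X$ is a totally ordered set of size at least $p+1$ (possibly infinite) such that, when $p \geq 2$, there exists a totally positive kernel on $X \times X$, then $F \circ K$ is $\mathrm{TP}_p$ for every symmetric $\mathrm{TP}_p$ kernel $K : X \times X \to \mathbb{R}$ if and only if $F$ satisfies (4).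
   Context: A real matrix is $\mathrm{TP}_p$ if all of its minors of size $r \times r$ with $1 \leq r \leq p$ are positive, and totally positive if all of its minors are positive. For a matrix $A = (a_{ij})$ with positive entries, $F[A] := (F(a_{ij}))$; "$F$ preserves a property entrywise" on a class of matrices means $F[A]$ has the property for every $A$ in the class which has it. For a totally ordered set $X$, a kernel $K : X \times X \to \mathbb{R}$ is $\mathrm{TP}_p$ if $\det(K(x_i,y_j))_{i,j=1}^n > 0$ for all $n \in \{1,\dots,p\}$ and all $x_1 < \cdots < x_n$, $y_1 < \cdots < y_n$ in $X$; totally positive if this holds for every $p$; symmetric if $K(x,y) = K(y,x)$. *)

theory Defs
  imports Complex_Main
    "Jordan_Normal_Form.Determinant"
    "Jordan_Normal_Form.DL_Submatrix"
begin

definition TP_mat :: "nat \<Rightarrow> real mat \<Rightarrow> bool" where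
  "TP_mat p A \<longleftrightarrow>
     (\<forall>I J. I \<subseteq> {..<dim_row A} \<and> J \<subseteq> {..<dim_col A} \<and> card I = card J \<and> card I \<in> {1..p}
        \<longrightarrow> det (submatrix A I J) > 0)"

definition totally_positive_mat :: "real mat \<Rightarrow> bool" where
  "totally_positive_mat A \<longleftrightarrow> (\<forall>p. TP_mat p A)"

text \<open>
  A kernel on a totally ordered set \<open>X\<close> is a total function of which only the values on
  \<open>X \<times> X\<close> matter. The finite increasing sequences in \<open>X\<close> are indexed from 0.
\<close>

definition TP_kernel :: "'a::linorder set \<Rightarrow> nat \<Rightarrow> ('a \<Rightarrow> 'a \<Rightarrow> real) \<Rightarrow> bool" where
  "TP_kernel X p K \<longleftrightarrow>
     (\<forall>n\<in>{1..p}. \<forall>x y. strict_mono_on {..<n} x \<and> x ` {..<n} \<subseteq> X \<and>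
        strict_mono_on {..<n} y \<and> y ` {..<n} \<subseteq> X
        \<longrightarrow> det (mat n n (\<lambda>(i, j). K (x i) (y j))) > 0)"

definition totally_positive_kernel :: "'a::linorder set \<Rightarrow> ('a \<Rightarrow> 'a \<Rightarrow> real) \<Rightarrow> bool" where
  "totally_positive_kernel X K \<longleftrightarrow> (\<forall>p. TP_kernel X p K)"

definition symmetric_kernel :: "'a set \<Rightarrow> ('a \<Rightarrow> 'a \<Rightarrow> real) \<Rightarrow> bool" where
  "symmetric_kernel X K \<longleftrightarrow> (\<forall>x\<in>X. \<forall>y\<in>X. K x y = K y x)"

text \<open>
  A function from the positive half-line to the reals is represented by a total function on
  the reals, whose values outside the half-line are irrelevant: for \<open>p \<ge> 1\<close> all entries of a
  \<open>TP_mat p\<close> matrix and all values on \<open>X \<times> X\<close> of a \<open>TP_kernel X p\<close> kernel are positive.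
\<close>

definition TP_preserver_form :: "nat \<Rightarrow> (real \<Rightarrow> real) \<Rightarrow> bool" where
  "TP_preserver_form p F \<longleftrightarrow>
     (p = 1 \<longrightarrow> (\<forall>x>0. F x > 0)) \<and>
     (p = 2 \<longrightarrow> (\<exists>c>0. \<exists>\<alpha>>0. \<forall>x>0. F x = c * x powr \<alpha>)) \<and>
     (p = 3 \<longrightarrow> (\<exists>c>0. \<exists>\<alpha>\<ge>1. \<forall>x>0. F x = c * x powr \<alpha>)) \<and>
     (p \<ge> 4 \<longrightarrow> (\<exists>c>0. \<forall>x>0. F x = c * x))"

end

theory Submission
  imports Defs "HOL-Library.FuncSet" "HOL-Real_Asymp.Real_Asymp"
begin

text \<open>
  Necessity for \<open>p \<ge> 2\<close>: the ratio of two columns of a totally positive kernel embeds \<open>X\<close>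
  into the reals by some \<open>\<phi>\<close>, and \<open>exp (x * y)\<close> is totally positive. Every 2 by 2 totally positive
  matrix is the block with rows \<open>x\<^sub>0, x\<^sub>1\<close> and columns \<open>x\<^sub>1, x\<^sub>2\<close> of a symmetric kernel
  \<open>w x * w y * exp (\<mu> * \<phi> x * \<phi> y)\<close>, so \<open>F b * F c < F a * F d\<close> whenever \<open>b * c < a * d\<close>, which
  forces \<open>F x = c * x powr \<alpha>\<close> with \<open>\<alpha> > 0\<close>. For \<open>p \<ge> 3\<close>, symmetric totally positive kernels on \<open>X\<close>
  can be made to approximate, on \<open>p + 1\<close> nodes, the matrix
  \<open>1 + \<epsilon> (i j + (i - 2)\<^sub>+ (j - 2)\<^sub>+)\<close>. For small \<open>\<epsilon>\<close> its entrywise power has a negative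
  leading 3 by 3 minor if \<open>\<alpha> < 1\<close>, and a negative 4 by 4 minor (rows 0 to 3, columns 1 to 4)
  if \<open>\<alpha> > 1\<close>.

  Sufficiency is only an issue for \<open>p = 3\<close>: after scaling the first row and column to 1,
  it follows from the elasticity of \<open>(1 + x) powr \<alpha> - 1\<close> being increasing in \<open>x\<close>.
\<close>

section \<open>Total positivity of the exponential kernel\<close>

lemma strict_mono_on_lessThanD:
  "strict_mono_on {..<n} f \<Longrightarrow> i < j \<Longrightarrow> j < n \<Longrightarrow> f i < f (j::nat)"
  by (auto simp: strict_mono_on_def)

text \<open>Induction by Rolle's theorem: after division by the last exponential its term is
  constant, and the derivative is a sum of \<open>n\<close> exponentials with \<open>n\<close> zeros
  interlacing the given ones.\<close>

lemma exp_sum_zeros_imp_zero: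
  fixes c y s :: "nat \<Rightarrow> real"
  assumes "inj_on y {..<n}" "strict_mono_on {..<n} s"
    and "\<And>i. i < n \<Longrightarrow> (\<Sum>j<n. c j * exp (s i * y j)) = 0"
    and "j < n"
  shows "c j = 0"
  using assms
proof (induction n arbitrary: c y s j)
  case 0
  then show ?case by simp
next
  case (Suc n)
  define g where "g t = (\<Sum>j<Suc n. c j * exp (t * (y j - y n)))" for t
  define g' where "g' t = (\<Sum>j<n. (c j * (y j - y n)) * exp (t * (y j - y n)))" for t
  have der: "(g has_real_derivative g' t) (at t)" for t
    unfolding g_def g'_def
    by (auto intro!: derivative_eq_intros sum.cong simp: sum.lessThan_Suc mult_ac)
  have g0: "g (s i) = 0" if "i < Suc n" for i
  proof -
    have "g (s i) = (\<Sum>j<Suc n. c j * exp (s i * y j)) * exp (- s i * y n)"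
      unfolding g_def sum_distrib_right
      by (intro sum.cong) (auto simp: mult.assoc algebra_simps simp flip: exp_add)
    then show ?thesis using Suc.prems(3)[OF that] by simp
  qed
  have "\<exists>z. s i < z \<and> z < s (Suc i) \<and> g' z = 0" if i: "i < n" for i
  proof -
    have "s i < s (Suc i)" using Suc.prems(2) i by (auto simp: strict_mono_on_def)
    moreover have "continuous_on {s i..s (Suc i)} g"
      by (rule DERIV_continuous_on[where D=g']) (rule has_field_derivative_at_within[OF der])
    ultimately obtain z where "s i < z" "z < s (Suc i)" "DERIV g z :> 0"
      using Rolle[of "s i" "s (Suc i)" g] g0[of i] g0[of "Suc i"] i der
      by (auto simp: real_differentiable_def)
    with der DERIV_unique show ?thesis by blast
  qed
  then obtain z where z: "\<And>i. i < n \<Longrightarrow> s i < z i \<and> z i < s (Suc i) \<and> g' (z i) = 0" by metis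
  have zm: "strict_mono_on {..<n} z"
  proof (rule strict_mono_onI)
    fix a b assume ab: "a \<in> {..<n}" "b \<in> {..<n}" "a < b"
    have "s (Suc a) \<le> s b"
      using Suc.prems(2) ab by (cases "Suc a = b") (auto simp: strict_mono_on_def intro!: less_imp_le)
    then show "z a < z b" using z[of a] z[of b] ab by force
  qed
  have inj: "inj_on (\<lambda>j. y j - y n) {..<n}"
    using Suc.prems(1) by (auto simp: inj_on_def)
  have "c j * (y j - y n) = 0" if "j < n" for j
    using Suc.IH[where c="\<lambda>j. c j * (y j - y n)" and y="\<lambda>j. y j - y n" and s=z, OF inj zm] z that
    by (auto simp: g'_def)
  moreover have "y j \<noteq> y n" if "j < n" for j
    using Suc.prems(1) that by (auto simp: inj_on_def)
  ultimately have cz: "c j = 0" if "j < n" for j using that by auto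
  then have "c n = 0" using Suc.prems(3)[of 0] by simp
  with cz Suc.prems(4) show ?case by (metis less_antisym)
qed

text \<open>The cofactors of the last row do not involve \<open>v\<close>; for
  \<open>v j = exp (t * y j)\<close> this displays the determinant as an exponential sum in
  \<open>t\<close>.\<close>

lemma det_replace_last_row:
  fixes v :: "nat \<Rightarrow> real"
  shows "det (mat (Suc n) (Suc n) (\<lambda>(i, j). if i < n then A i j else v j)) =
    (\<Sum>j<Suc n. v j * ((-1) ^ (n + j) * det (mat n n (\<lambda>(i, k). A i (if k < j then k else Suc k)))))"
proof -
  let ?M = "mat (Suc n) (Suc n) (\<lambda>(i, j). if i < n then A i j else v j)"
  have "mat_delete ?M n j = mat n n (\<lambda>(i, k). A i (if k < j then k else Suc k))" if "j < Suc n" for j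
    by (rule eq_matI) (auto simp: mat_delete_def)
  then show ?thesis
    by (subst laplace_expansion_row[where i=n]) (auto simp: cofactor_def intro!: sum.cong)
qed

text \<open>After division by \<open>exp (t * y n)\<close>, the fastest growing exponential, all
  other terms decay and the value tends to \<open>c n\<close>.\<close>

lemma exp_sum_pos_at_top:
  fixes c y :: "nat \<Rightarrow> real"
  assumes "strict_mono_on {..<Suc n} y" "c n > 0"
  shows "eventually (\<lambda>t. (\<Sum>j<Suc n. c j * exp (t * y j)) > 0) at_top"
proof -
  have lim: "((\<lambda>t. c j * exp (t * (y j - y n))) \<longlongrightarrow> 0) at_top" if "j < n" for j
  proof -
    have "y j - y n < 0" using assms(1) that by (auto simp: strict_mono_on_def)
    then have "LIM t at_top. t * (y j - y n) :> at_bot"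
      by (subst mult.commute) (rule filterlim_tendsto_neg_mult_at_bot[OF tendsto_const _ filterlim_ident], simp)
    then have "((\<lambda>t. exp (t * (y j - y n))) \<longlongrightarrow> 0) at_top"
      by (rule filterlim_compose[OF exp_at_bot])
    then show ?thesis by (intro tendsto_mult_right_zero)
  qed
  have "((\<lambda>t. (\<Sum>j<n. c j * exp (t * (y j - y n))) + c n) \<longlongrightarrow> (\<Sum>j<n. 0) + c n) at_top"
    by (intro tendsto_add tendsto_sum lim tendsto_const) auto
  then have "eventually (\<lambda>t. (\<Sum>j<n. c j * exp (t * (y j - y n))) + c n > 0) at_top"
    using assms(2) by (auto dest: order_tendstoD)
  then show ?thesis
  proof eventually_elim
    case (elim t)
    have "(\<Sum>j<Suc n. c j * exp (t * y j)) =
        exp (t * y n) * ((\<Sum>j<n. c j * exp (t * (y j - y n))) + c n)"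
      by (simp add: distrib_left sum_distrib_left mult.left_commute algebra_simps flip: exp_add)
    then show ?case using elim by simp
  qed
qed

text \<open>As a function of its last row parameter the determinant is an exponential sum with \<open>n\<close>
  known zeros and a positive top coefficient, so it has no further zero.\<close>

lemma det_exp_pos:
  fixes x y :: "nat \<Rightarrow> real"
  assumes "strict_mono_on {..<n} x" "strict_mono_on {..<n} y"
  shows "det (mat n n (\<lambda>(i, j). exp (x i * y j))) > 0"
  using assms
proof (induction n)
  case 0
  then show ?case by simp
next
  case (Suc n)
  let ?E = "\<lambda>i j. exp (x i * y j)"
  define C where "C j = (-1) ^ (n + j) * det (mat n n (\<lambda>(i, k). ?E i (if k < j then k else Suc k)))" for j
  define f where "f t = (\<Sum>j<Suc n. C j * exp (t * y j))" for t
  have f_det: "f t = det (mat (Suc n) (Suc n) (\<lambda>(i, j). if i < n then ?E i j else exp (t * y j)))" for t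
    unfolding f_def C_def det_replace_last_row by (simp add: mult_ac)
  \<comment> \<open>The top coefficient is the minor with rows and columns below \<open>n\<close>,
    positive by induction; its sign factor is \<open>(-1) ^ (n + n)\<close>.\<close>
  have "mat n n (\<lambda>(i, k). ?E i (if k < n then k else Suc k)) = mat n n (\<lambda>(i, k). ?E i k)"
    by (rule eq_matI) auto
  then have Cn: "C n > 0"
    using Suc.IH Suc.prems by (auto simp: C_def strict_mono_on_def)
  have f0: "f (x i) = 0" if "i < n" for i
    unfolding f_det
    by (rule det_identical_rows[of _ "Suc n" i n]) (use that in \<open>auto intro!: eq_vecI\<close>)
  have inj: "inj_on y {..<Suc n}" using Suc.prems(2) strict_mono_on_imp_inj_on by blast
  have nz: "f t \<noteq> 0" if t: "\<And>i. i < n \<Longrightarrow> x i < t" for t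
  proof
    assume "f t = 0"
    \<comment> \<open>The nodes \<open>x i\<close> together with \<open>t\<close> would be
      \<open>Suc n\<close> zeros of a sum with \<open>Suc n\<close> terms.\<close>
    let ?s = "\<lambda>i. if i < n then x i else t"
    have "strict_mono_on {..<Suc n} ?s"
      using Suc.prems(1) t by (auto simp: strict_mono_on_def)
    moreover have "(\<Sum>j<Suc n. C j * exp (?s i * y j)) = 0" if "i < Suc n" for i
      using f0[of i] \<open>f t = 0\<close> unfolding f_def by auto
    ultimately have "C n = 0"
      by (rule exp_sum_zeros_imp_zero[OF inj]) auto
    then show False using Cn by simp
  qed
  have "eventually (\<lambda>t. f t > 0) at_top"
    unfolding f_def using exp_sum_pos_at_top[where c=C and n=n and y=y] Suc.prems(2) Cn by blast
  then obtain T where T: "\<And>t. t \<ge> T \<Longrightarrow> f t > 0" by (auto simp: eventually_at_top_linorder)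
  \<comment> \<open>A nonpositive value at \<open>x n\<close> would produce a zero at or beyond
    \<open>x n\<close>, because \<open>f\<close> is positive for large arguments.\<close>
  have "f (x n) > 0"
  proof (rule ccontr)
    assume neg: "\<not> f (x n) > 0"
    let ?T = "max T (x n)"
    have "\<exists>t\<ge>x n. t \<le> ?T \<and> f t = 0"
      by (rule IVT') (use neg T[of ?T] in \<open>auto simp: f_def intro!: continuous_intros\<close>)
    then obtain t where "t \<ge> x n" "f t = 0" by auto
    have "x i < t" if "i < n" for i
      using strict_mono_on_lessThanD[OF Suc.prems(1) that] \<open>t \<ge> x n\<close> by simp
    with nz[of t] \<open>f t = 0\<close> show False by blast
  qed
  moreover have "mat (Suc n) (Suc n) (\<lambda>(i, j). if i < n then ?E i j else exp (x n * y j)) =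
      mat (Suc n) (Suc n) (\<lambda>(i, j). ?E i j)"
    by (rule eq_matI) (auto simp: less_Suc_eq)
  ultimately show ?case unfolding f_det by simp
qed

section \<open>Families of columns and their Gram kernels\<close>

lemma det_scale_rows_cols:
  fixes a b :: "nat \<Rightarrow> real"
  shows "det (mat n n (\<lambda>(i, j). a i * b j * M i j)) =
    (\<Prod>i<n. a i) * (\<Prod>j<n. b j) * det (mat n n (\<lambda>(i, j). M i j))"
proof -
  have "(\<Prod>i<n. b (p i)) = (\<Prod>j<n. b j)" if "p permutes {..<n}" for p
    using prod.permute[OF that, of b] by (simp add: o_def)
  then show ?thesis
    by (subst (1 2) det_def'[where n=n])
       (auto simp: prod.distrib sum_distrib_left mult_ac atLeast0LessThan permutes_in_image intro!: sum.cong)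
qed

text \<open>Expansion along column \<open>m\<close>: its cofactors do not see that column.\<close>

lemma det_col_add:
  fixes M :: "nat \<Rightarrow> nat \<Rightarrow> real"
  assumes "m < n"
  shows "det (mat n n (\<lambda>(i, j). if j = m then u i + v i else M i j)) =
    det (mat n n (\<lambda>(i, j). if j = m then u i else M i j)) +
    det (mat n n (\<lambda>(i, j). if j = m then v i else M i j))"
proof -
  let ?A = "\<lambda>w. mat n n (\<lambda>(i, j). if j = m then w i else M i j)"
  have del: "mat_delete (?A w) i m = mat_delete (?A u) i m" if "i < n" for w i
    using assms that by (auto simp: mat_delete_def intro!: eq_matI)
  have "det (?A w) = (\<Sum>i<n. w i * cofactor (?A u) i m)" for w
  proof -
    have "det (?A w) = (\<Sum>i<n. ?A w $$ (i, m) * cofactor (?A w) i m)"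
      by (rule laplace_expansion_column[OF _ assms]) simp
    also have "\<dots> = (\<Sum>i<n. w i * cofactor (?A u) i m)"
      unfolding cofactor_def by (intro sum.cong) (use assms in \<open>simp_all only: lessThan_iff del[of _ w]\<close>, simp)
    finally show ?thesis .
  qed
  then show ?thesis by (simp add: sum.distrib distrib_right)
qed

text \<open>Cauchy-Binet summed over all index maps instead of increasing ones: each set of
  \<open>n\<close> indices is hit \<open>n!\<close> times, whence the factorial, and maps that are
  not injective contribute 0. The rows are expanded multilinearly, then the result is averaged over
  relabelings of the index map.\<close>

lemma det_Cauchy_Binet_symmetrized:
  fixes A B :: "nat \<Rightarrow> nat \<Rightarrow> real"
  shows "fact n * det (mat n n (\<lambda>(i, j). \<Sum>k<N. A i k * B k j)) =
    (\<Sum>f\<in>{0..<n} \<rightarrow>\<^sub>E {..<N}. det (mat n n (\<lambda>(i, j). A i (f j))) * det (mat n n (\<lambda>(i, j). B (f i) j)))"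
proof -
  let ?P = "{p. p permutes {0..<n}}" and ?F = "{0..<n} \<rightarrow>\<^sub>E {..<N}"
  let ?B = "\<lambda>f. det (mat n n (\<lambda>(i, j). B (f i) j))"
  have fin: "finite ?F" by (intro finite_PiE) auto
  have expand: "det (mat n n (\<lambda>(i, j). \<Sum>k<N. A i k * B k j)) = (\<Sum>f\<in>?F. (\<Prod>i=0..<n. A i (f i)) * ?B f)"
    (is "?D = _")
  proof -
    have "?D = (\<Sum>p\<in>?P. signof p * (\<Prod>i=0..<n. \<Sum>k<N. A i k * B k (p i)))"
      by (subst det_def'[where n=n]) (auto intro!: sum.cong prod.cong simp: permutes_in_image)
    also have "\<dots> = (\<Sum>p\<in>?P. signof p * (\<Sum>f\<in>?F. \<Prod>i=0..<n. A i (f i) * B (f i) (p i)))"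
      by (subst prod_sum_PiE) auto
    also have "\<dots> = (\<Sum>f\<in>?F. (\<Prod>i=0..<n. A i (f i)) * (\<Sum>p\<in>?P. signof p * (\<Prod>i=0..<n. B (f i) (p i))))"
      unfolding sum_distrib_left by (subst sum.swap) (simp add: prod.distrib mult_ac)
    also have "\<dots> = (\<Sum>f\<in>?F. (\<Prod>i=0..<n. A i (f i)) * ?B f)"
      by (intro sum.cong refl arg_cong2[where f="(*)"], subst det_def'[where n=n])
         (auto intro!: sum.cong prod.cong simp: permutes_in_image)
    finally show ?thesis .
  qed
  \<comment> \<open>Reindexing by \<open>f \<circ> p\<close> moves \<open>p\<close> into the product
    over \<open>A\<close> and releases its sign from the minor of \<open>B\<close>; summing over
    \<open>p\<close> then assembles the minor of \<open>A\<close>.\<close>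
  have perm: "?D = (\<Sum>f\<in>?F. signof p * (\<Prod>i=0..<n. A i (f (p i))) * ?B f)" if p: "p permutes {0..<n}" for p
  proof -
    have inv: "inv_into UNIV p permutes {0..<n}" using p by (rule permutes_inv)
    have in_F: "f \<circ> q \<in> ?F" if "q permutes {0..<n}" "f \<in> ?F" for f q
      using that permutes_in_image[OF that(1)] permutes_not_in[OF that(1)]
      by (auto simp: PiE_def extensional_def Pi_def)
    have "?D = (\<Sum>f\<in>?F. (\<Prod>i=0..<n. A i ((f \<circ> p) i)) * ?B (f \<circ> p))"
      unfolding expand
      by (rule sum.reindex_bij_witness[of _ "\<lambda>f. f \<circ> p" "\<lambda>f. f \<circ> inv_into UNIV p"])
         (use in_F[OF p] in_F[OF inv] p in \<open>auto simp: o_assoc[symmetric] permutes_inv_o simp del: o_apply\<close>)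
    moreover have "?B (f \<circ> p) = signof p * ?B f" for f
    proof -
      have "mat n n (\<lambda>(i, j). mat n n (\<lambda>(i, j). B (f i) j) $$ (p i, j)) = mat n n (\<lambda>(i, j). B ((f \<circ> p) i) j)"
        using permutes_in_image[OF p] by (intro eq_matI) auto
      then show ?thesis
        using det_permute_rows[of "mat n n (\<lambda>(i, j). B (f i) j)" n p] p by simp
    qed
    ultimately show ?thesis by (simp add: mult_ac)
  qed
  have "fact n * ?D = (\<Sum>p\<in>?P. ?D)"
    by (simp add: card_permutations[of _ n])
  also have "\<dots> = (\<Sum>p\<in>?P. \<Sum>f\<in>?F. signof p * (\<Prod>i=0..<n. A i (f (p i))) * ?B f)"
    by (rule sum.cong[OF refl]) (use perm in blast)
  also have "\<dots> = (\<Sum>f\<in>?F. (\<Sum>p\<in>?P. signof p * (\<Prod>i=0..<n. A i (f (p i)))) * ?B f)"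
    by (subst sum.swap) (simp add: sum_distrib_right)
  also have "\<dots> = (\<Sum>f\<in>?F. det (mat n n (\<lambda>(i, j). A i (f j))) * ?B f)"
    by (intro sum.cong refl arg_cong2[where f="(*)"], subst det_def'[where n=n])
       (auto intro!: sum.cong prod.cong simp: permutes_in_image)
  finally show ?thesis .
qed

text \<open>Lets an injective index map in the Cauchy-Binet sum be replaced by an increasing one.
  The permutation sends \<open>i\<close> to the preimage of the value of rank
  \<open>i\<close>.\<close>

lemma exists_sorting_permutation:
  fixes f :: "nat \<Rightarrow> nat"
  assumes "inj_on f {0..<n}"
  obtains p where "p permutes {0..<n}" "strict_mono_on {..<n} (f \<circ> p)"
proof -
  let ?I = "f ` {0..<n}"
  have card: "card ?I = n" using assms by (simp add: card_image)
  have pick: "pick ?I i \<in> ?I" if "i < n" for i using that card by (intro pick_in_set_le) simp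
  have mono: "pick ?I i < pick ?I j" if "i < j" "j < n" for i j
    using that card by (intro pick_mono_le) auto
  define p where "p i = (if i < n then inv_into {0..<n} f (pick ?I i) else i)" for i
  have fp: "f (p i) = pick ?I i" if "i < n" for i
    using pick[OF that] that by (simp add: p_def f_inv_into_f)
  have ran: "p i < n" if "i < n" for i
    using inv_into_into[OF pick[OF that]] that by (simp add: p_def)
  have "inj_on p {0..<n}"
  proof (rule inj_onI)
    fix i j assume "i \<in> {0..<n}" "j \<in> {0..<n}" "p i = p j"
    then have "pick ?I i = pick ?I j" "i < n" "j < n" using fp by (metis atLeastLessThan_iff)+
    then show "i = j" using mono by (metis linorder_neqE_nat less_irrefl)
  qed
  moreover have "p ` {0..<n} \<subseteq> {0..<n}" using ran by auto
  ultimately have "bij_betw p {0..<n} {0..<n}"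
    by (simp add: bij_betw_def endo_inj_surj)
  then have "p permutes {0..<n}" by (rule bij_imp_permutes) (simp add: p_def)
  moreover have "strict_mono_on {..<n} (f \<circ> p)"
    using mono fp by (auto simp: strict_mono_on_def)
  ultimately show thesis by (rule that)
qed

text \<open>Rows come from \<open>X\<close> and columns from finitely many indices, so that columns
  can be added and weighted without touching \<open>X\<close>; minors of all sizes are
  included.\<close>

definition TP_family :: "'a::linorder set \<Rightarrow> nat \<Rightarrow> ('a \<Rightarrow> nat \<Rightarrow> real) \<Rightarrow> bool" where
  "TP_family X N H \<longleftrightarrow>
     (\<forall>n x y. strict_mono_on {..<n} x \<and> x ` {..<n} \<subseteq> X \<and>
        strict_mono_on {..<n} y \<and> y ` {..<n} \<subseteq> {..<N}
        \<longrightarrow> det (mat n n (\<lambda>(i, j). H (x i) (y j))) > 0)"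

lemma TP_familyD:
  "TP_family X N H \<Longrightarrow> strict_mono_on {..<n} x \<Longrightarrow> (\<And>i. i < n \<Longrightarrow> x i \<in> X) \<Longrightarrow>
    strict_mono_on {..<n} y \<Longrightarrow> (\<And>i. i < n \<Longrightarrow> y i < N) \<Longrightarrow>
    det (mat n n (\<lambda>(i, j). H (x i) (y j))) > 0"
  unfolding TP_family_def by (auto simp: image_subset_iff)

lemma TP_family_cong:
  assumes "TP_family X N H" "\<And>x k. x \<in> X \<Longrightarrow> k < N \<Longrightarrow> H' x k = H x k"
  shows "TP_family X N H'"
  unfolding TP_family_def
proof safe
  fix n :: nat and x y assume *: "strict_mono_on {..<n} x" "x ` {..<n} \<subseteq> X"
    "strict_mono_on {..<n} y" "y ` {..<n} \<subseteq> {..<N}"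
  have "mat n n (\<lambda>(i, j). H' (x i) (y j)) = mat n n (\<lambda>(i, j). H (x i) (y j))"
    using * assms(2) by (intro eq_matI) (auto simp: image_subset_iff)
  then show "det (mat n n (\<lambda>(i, j). H' (x i) (y j))) > 0"
    using TP_familyD[OF assms(1) *(1) _ *(3)] *(2,4) by (auto simp: image_subset_iff)
qed

lemma TP_family_scale:
  assumes "TP_family X N H" "\<And>x. x \<in> X \<Longrightarrow> a x > 0" "\<And>k. k < N \<Longrightarrow> b k > 0"
  shows "TP_family X N (\<lambda>x k. a x * b k * H x k)"
  unfolding TP_family_def det_scale_rows_cols
  using assms by (auto simp: TP_family_def image_subset_iff intro!: mult_pos_pos prod_pos)

lemma TP_family_exp:
  assumes "strict_mono_on X \<phi>" "strict_mono_on {..<N} s"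
  shows "TP_family X N (\<lambda>x k. exp (\<phi> x * s k))"
  unfolding TP_family_def
proof (intro allI impI, elim conjE)
  fix n :: nat and x y assume *: "strict_mono_on {..<n} x" "x ` {..<n} \<subseteq> X"
    "strict_mono_on {..<n} y" "y ` {..<n} \<subseteq> {..<N}"
  show "det (mat n n (\<lambda>(i, j). exp (\<phi> (x i) * s (y j)))) > 0"
    using assms * by (intro det_exp_pos) (auto simp: strict_mono_on_def image_subset_iff)
qed

text \<open>By linearity a minor that uses column \<open>m\<close> splits into the old minor and the
  one with \<open>m\<close> replaced by \<open>Suc m\<close>. The latter is zero if column
  \<open>Suc m\<close> already occurs, and otherwise its indices are still increasing.\<close>

lemma TP_family_add_next_col:
  assumes "TP_family X N H" "Suc m < N"
  shows "TP_family X N (\<lambda>x k. if k = m then H x m + H x (Suc m) else H x k)"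
  unfolding TP_family_def
proof (intro allI impI, elim conjE)
  fix n :: nat and x y assume x: "strict_mono_on {..<n} x" "x ` {..<n} \<subseteq> X"
    and y: "strict_mono_on {..<n} y" "y ` {..<n} \<subseteq> {..<N}"
  let ?H' = "\<lambda>x k. if k = m then H x m + H x (Suc m) else H x k"
  have pos: "det (mat n n (\<lambda>(i, j). H (x i) (y' j))) > 0"
    if "strict_mono_on {..<n} y'" "\<And>i. i < n \<Longrightarrow> y' i < N" for y'
    using TP_familyD[OF assms(1) x(1) _ that] x(2) by auto
  show "det (mat n n (\<lambda>(i, j). ?H' (x i) (y j))) > 0"
  proof (cases "\<exists>l<n. y l = m")
    case False
    then have "mat n n (\<lambda>(i, j). ?H' (x i) (y j)) = mat n n (\<lambda>(i, j). H (x i) (y j))"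
      by (intro eq_matI) auto
    then show ?thesis using pos y by auto
  next
    case True
    then obtain l where l: "l < n" "y l = m" by blast
    have iff: "y j = m \<longleftrightarrow> j = l" if "j < n" for j
      using l that strict_mono_on_imp_inj_on[OF y(1)] by (auto simp: inj_on_def)
    let ?N = "mat n n (\<lambda>(i, j). H (x i) ((y(l := Suc m)) j))"
    have "mat n n (\<lambda>(i, j). ?H' (x i) (y j)) =
        mat n n (\<lambda>(i, j). if j = l then H (x i) m + H (x i) (Suc m) else H (x i) (y j))"
      using iff by (intro eq_matI) auto
    then have "det (mat n n (\<lambda>(i, j). ?H' (x i) (y j))) =
        det (mat n n (\<lambda>(i, j). if j = l then H (x i) m else H (x i) (y j))) +
        det (mat n n (\<lambda>(i, j). if j = l then H (x i) (Suc m) else H (x i) (y j)))"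
      by (simp only: det_col_add[OF l(1)])
    also have "mat n n (\<lambda>(i, j). if j = l then H (x i) m else H (x i) (y j)) =
        mat n n (\<lambda>(i, j). H (x i) (y j))"
      using l by (intro eq_matI) auto
    also have "mat n n (\<lambda>(i, j). if j = l then H (x i) (Suc m) else H (x i) (y j)) = ?N"
      by (intro eq_matI) auto
    finally have eq: "det (mat n n (\<lambda>(i, j). ?H' (x i) (y j))) =
        det (mat n n (\<lambda>(i, j). H (x i) (y j))) + det ?N" .
    have "det ?N \<ge> 0"
    proof (cases "Suc l < n \<and> y (Suc l) = Suc m")
      case True
      then have "det ?N = 0"
        by (intro det_identical_columns[of _ n l "Suc l"]) (auto intro!: eq_vecI)
      then show ?thesis by simp
    next
      case False
      have "strict_mono_on {..<n} (y(l := Suc m))"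
      proof (rule strict_mono_onI)
        fix a b assume ab: "a \<in> {..<n}" "b \<in> {..<n}" "a < b"
        have yab: "y a < y b" using ab strict_mono_on_lessThanD[OF y(1)] by auto
        show "(y(l := Suc m)) a < (y(l := Suc m)) b"
        proof (cases "a = l")
          case True
          have "Suc l < n" using ab True by auto
          have "y (Suc l) \<le> y b"
            using ab True y(1) by (cases "b = Suc l") (auto simp: strict_mono_on_def intro!: less_imp_le)
          moreover have "y (Suc l) > m" using l \<open>Suc l < n\<close> strict_mono_on_lessThanD[OF y(1), of l "Suc l"] by auto
          ultimately show ?thesis using False True ab l \<open>Suc l < n\<close> by auto
        next
          case False
          then show ?thesis using yab l by auto
        qed
      qed
      then show ?thesis
        by (intro less_imp_le pos) (use y(2) assms(2) in \<open>auto simp: fun_upd_def\<close>)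
    qed
    then show ?thesis using eq pos[OF y(1)] y(2) by fastforce
  qed
qed

text \<open>Suffix sums are built from the right: the next column already holds its suffix sum when
  it is added. The bound \<open>s\<close> allows the columns before it to be spared.\<close>

lemma TP_family_cumulative:
  assumes "TP_family X N H" "s \<le> N"
  shows "TP_family X N (\<lambda>x k. if s \<le> k then \<Sum>l\<in>{k..<N}. H x l else H x k)"
  using assms(2)
proof (induction s rule: inc_induct)
  case base
  show ?case by (rule TP_family_cong[OF assms(1)]) auto
next
  case (step s)
  let ?H = "\<lambda>s x k. if s \<le> k then \<Sum>l\<in>{k..<N}. H x l else H x k"
  show ?case
  proof (cases "Suc s < N")
    case True
    show ?thesis
      by (rule TP_family_cong[OF TP_family_add_next_col[OF step.IH True]])
         (use True in \<open>auto simp: sum.atLeast_Suc_lessThan[of s N] not_less_eq_eq le_Suc_eq\<close>)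
  next
    case False
    \<comment> \<open>The last column is its own suffix sum.\<close>
    have "(if s \<le> k then \<Sum>l\<in>{k..<N}. H x l else H x k) =
        (if Suc s \<le> k then \<Sum>l\<in>{k..<N}. H x l else H x k)" if "k < N" for x k
    proof -
      have "N = Suc s" using False step by simp
      then show ?thesis using that by (cases "k = s") auto
    qed
    then show ?thesis by (rule TP_family_cong[OF step.IH])
  qed
qed

text \<open>By Cauchy-Binet every minor is, up to the factor \<open>n!\<close>, a sum of products of
  two minors of \<open>H\<close> with positive weights; none of the products is negative and one is
  positive.\<close>

lemma TP_kernel_Gram:
  assumes H: "TP_family X N H" and w: "\<And>k. k < N \<Longrightarrow> w k > 0" and "p \<le> N"
  shows "TP_kernel X p (\<lambda>x y. \<Sum>k<N. w k * H x k * H y k)"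
  unfolding TP_kernel_def
proof (intro ballI allI impI, elim conjE)
  fix n :: nat and x y assume n: "n \<in> {1..p}" and x: "strict_mono_on {..<n} x" "x ` {..<n} \<subseteq> X"
    and y: "strict_mono_on {..<n} y" "y ` {..<n} \<subseteq> X"
  let ?F = "{0..<n} \<rightarrow>\<^sub>E {..<N}"
  let ?D = "\<lambda>f. det (mat n n (\<lambda>(i, j). w (f j) * H (x i) (f j))) * det (mat n n (\<lambda>(i, j). H (y j) (f i)))"
  have pos: "det (mat n n (\<lambda>(i, j). w (f j) * H (x i) (f j))) > 0"
       "det (mat n n (\<lambda>(i, j). H (y j) (f i))) > 0"
    if "strict_mono_on {..<n} f" "\<And>i. i < n \<Longrightarrow> f i < N" for f
  proof -
    show "det (mat n n (\<lambda>(i, j). w (f j) * H (x i) (f j))) > 0"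
      using det_scale_rows_cols[of n "\<lambda>_. 1" "\<lambda>j. w (f j)" "\<lambda>i j. H (x i) (f j)"]
        TP_familyD[OF H x(1) _ that] x(2) w that(2) by (auto intro!: mult_pos_pos prod_pos)
    have "mat n n (\<lambda>(i, j). H (y j) (f i)) = transpose_mat (mat n n (\<lambda>(i, j). H (y i) (f j)))"
      by (intro eq_matI) auto
    then show "det (mat n n (\<lambda>(i, j). H (y j) (f i))) > 0"
      using TP_familyD[OF H y(1) _ that] y(2) by (auto simp: det_transpose[of _ n])
  qed
  \<comment> \<open>Sorting \<open>f\<close> reorders both factors by the same permutation, so its
    sign enters squared.\<close>
  have nonneg: "?D f \<ge> 0" if f: "f \<in> ?F" for f
  proof (cases "inj_on f {0..<n}")
    case True
    then obtain q where q: "q permutes {0..<n}" "strict_mono_on {..<n} (f \<circ> q)"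
      by (rule exists_sorting_permutation)
    let ?A = "mat n n (\<lambda>(i, j). w (f i) * H (x j) (f i))" and ?B = "mat n n (\<lambda>(i, j). H (y j) (f i))"
    let ?A' = "mat n n (\<lambda>(i, j). w ((f \<circ> q) i) * H (x j) ((f \<circ> q) i))"
      and ?B' = "mat n n (\<lambda>(i, j). H (y j) ((f \<circ> q) i))"
    have qn: "q i < n" if "i < n" for i using q(1) that permutes_in_image[of q "{0..<n}" i] by auto
    have ran: "(f \<circ> q) i < N" if "i < n" for i
      using f qn[OF that] by (auto simp: PiE_def Pi_def)
    have tr: "det (mat n n (\<lambda>(i, j). w (g j) * H (x i) (g j))) = det (mat n n (\<lambda>(i, j). w (g i) * H (x j) (g i)))" for g
      by (subst det_transpose[symmetric, of _ n]) (auto intro!: arg_cong[where f=det] eq_matI)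
    have "mat n n (\<lambda>(i, j). ?A $$ (q i, j)) = ?A'" "mat n n (\<lambda>(i, j). ?B $$ (q i, j)) = ?B'"
      using qn by (auto intro!: eq_matI)
    then have "det ?A' = signof q * det ?A" "det ?B' = signof q * det ?B"
      using det_permute_rows[of ?A n q] det_permute_rows[of ?B n q] q(1) by auto
    moreover have "signof q * signof q = (1::real)" by (simp add: sign_def)
    ultimately have "?D f = det ?A' * det ?B'" unfolding tr by (simp add: mult_ac)
    also have "\<dots> > 0" using pos[OF q(2) ran] unfolding tr by simp
    finally show ?thesis by simp
  next
    case False
    then obtain a b where "a < n" "b < n" "a \<noteq> b" "f a = f b" by (auto simp: inj_on_def)
    then have "det (mat n n (\<lambda>(i, j). H (y j) (f i))) = 0"
      by (intro det_identical_rows[of _ n a b]) (auto intro!: eq_vecI)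
    then show ?thesis by simp
  qed
  \<comment> \<open>The identity map selects columns \<open>0\<close> to \<open>n - 1\<close>,
    available because \<open>n \<le> p \<le> N\<close>; its summand is strictly positive.\<close>
  let ?f = "\<lambda>i\<in>{0..<n}. i"
  have "strict_mono_on {..<n} ?f" "\<And>i. i < n \<Longrightarrow> ?f i < N"
    using n \<open>p \<le> N\<close> by (auto simp: strict_mono_on_def)
  then have "?D ?f > 0" by (intro mult_pos_pos pos)
  moreover have "?f \<in> ?F" using n \<open>p \<le> N\<close> by auto
  ultimately have "(\<Sum>f\<in>?F. ?D f) > 0"
    using nonneg by (intro sum_pos2[where i="?f"] finite_PiE) auto
  then have "fact n * det (mat n n (\<lambda>(i, j). \<Sum>k<N. w k * H (x i) k * H (y j) k)) > 0"
    using det_Cauchy_Binet_symmetrized[of n "\<lambda>i k. w k * H (x i) k" "\<lambda>k j. H (y j) k" N] by simp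
  then show "det (mat n n (\<lambda>(i, j). \<Sum>k<N. w k * H (x i) k * H (y j) k)) > 0"
    by (simp add: zero_less_mult_iff)
qed

section \<open>Matrices as kernels\<close>

text \<open>Exactly \<open>i\<close> elements of the image lie below \<open>x i\<close>. This
  matches the enumeration behind \<open>submatrix\<close> with increasing sequences.\<close>

lemma pick_image_strict_mono:
  fixes x :: "nat \<Rightarrow> nat"
  assumes "strict_mono_on {..<n} x" "i < n"
  shows "pick (x ` {..<n}) i = x i"
proof -
  have less_iff: "x j < x i \<longleftrightarrow> j < i" if "j < n" for j
    using assms that by (simp add: strict_mono_on_less)
  have "{a \<in> x ` {..<n}. a < x i} = x ` {..<i}"
    using assms(2) less_iff by auto
  moreover have "inj_on x {..<i}"
    using strict_mono_on_imp_inj_on[OF assms(1)] assms(2) by (auto intro: inj_on_subset)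
  ultimately have "card {a \<in> x ` {..<n}. a < x i} = i" by (simp add: card_image)
  then show ?thesis using pick_card_in_set[of "x i" "x ` {..<n}"] assms(2) by auto
qed

lemma strict_mono_on_pick: "finite I \<Longrightarrow> strict_mono_on {..<card I} (pick I)"
  by (auto simp: strict_mono_on_def intro: pick_mono_le)

lemma TP_kernel_cong:
  assumes "\<And>x y. x \<in> X \<Longrightarrow> y \<in> X \<Longrightarrow> K x y = K' x y"
  shows "TP_kernel X p K \<longleftrightarrow> TP_kernel X p K'"
proof -
  have "mat n n (\<lambda>(i, j). K (x i) (y j)) = mat n n (\<lambda>(i, j). K' (x i) (y j))"
    if "x ` {..<n} \<subseteq> X" "y ` {..<n} \<subseteq> X" for n and x y :: "nat \<Rightarrow> 'a"
    using assms that by (intro eq_matI) (auto simp: image_subset_iff)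
  then show ?thesis unfolding TP_kernel_def by metis
qed

text \<open>Makes the matrix statements instances of the kernel statements, with
  \<open>X = {..<d}\<close>.\<close>

lemma TP_mat_iff_TP_kernel:
  assumes A: "A \<in> carrier_mat d d"
  shows "TP_mat p A \<longleftrightarrow> TP_kernel {..<d} p (\<lambda>i j. A $$ (i, j))"
proof
  assume TP: "TP_mat p A"
  show "TP_kernel {..<d} p (\<lambda>i j. A $$ (i, j))"
    unfolding TP_kernel_def
  proof (intro ballI allI impI, elim conjE)
    fix n :: nat and x y :: "nat \<Rightarrow> nat"
    assume n: "n \<in> {1..p}" and x: "strict_mono_on {..<n} x" "x ` {..<n} \<subseteq> {..<d}"
      and y: "strict_mono_on {..<n} y" "y ` {..<n} \<subseteq> {..<d}"
    let ?I = "x ` {..<n}" and ?J = "y ` {..<n}"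
    have card: "card ?I = n" "card ?J = n"
      using x(1) y(1) by (simp_all add: card_image strict_mono_on_imp_inj_on)
    have "{i. i < d \<and> i \<in> ?I} = ?I" "{i. i < d \<and> i \<in> ?J} = ?J" using x(2) y(2) by auto
    then have "submatrix A ?I ?J = mat n n (\<lambda>(i, j). A $$ (x i, y j))"
      using A card x(1) y(1) by (auto simp: submatrix_def pick_image_strict_mono intro!: eq_matI)
    then show "det (mat n n (\<lambda>(i, j). A $$ (x i, y j))) > 0"
      using TP A n x(2) y(2) card unfolding TP_mat_def by (metis carrier_matD)
  qed
next
  assume TP: "TP_kernel {..<d} p (\<lambda>i j. A $$ (i, j))"
  show "TP_mat p A"
    unfolding TP_mat_def
  proof (intro allI impI, elim conjE)
    fix I J assume I: "I \<subseteq> {..<dim_row A}" and J: "J \<subseteq> {..<dim_col A}"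
      and card: "card I = card J" "card I \<in> {1..p}"
    have fin: "finite I" "finite J" using I J finite_subset by blast+
    have "{i. i < dim_row A \<and> i \<in> I} = I" "{i. i < dim_col A \<and> i \<in> J} = J" using I J by auto
    then have "submatrix A I J = mat (card I) (card I) (\<lambda>(i, j). A $$ (pick I i, pick J j))"
      using card by (simp add: submatrix_def)
    moreover have "strict_mono_on {..<card I} (pick I)" "strict_mono_on {..<card I} (pick J)"
      using strict_mono_on_pick fin card(1) by metis+
    moreover have "pick I ` {..<card I} \<subseteq> {..<d}" "pick J ` {..<card I} \<subseteq> {..<d}"
      using I J A card(1) pick_in_set_le[of _ I] pick_in_set_le[of _ J] by force+
    ultimately show "det (submatrix A I J) > 0"
      using TP card(2) unfolding TP_kernel_def by auto
  qed
qed

lemma totally_positive_mat_iff_TP_mat: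
  assumes A: "A \<in> carrier_mat p p"
  shows "totally_positive_mat A \<longleftrightarrow> TP_mat p A"
proof -
  have "TP_mat q A" if TP: "TP_mat p A" for q
    unfolding TP_mat_def
  proof (intro allI impI, elim conjE)
    fix I J assume *: "I \<subseteq> {..<dim_row A}" "J \<subseteq> {..<dim_col A}" "card I = card J" "card I \<in> {1..q}"
    then have "card I \<le> p" using A card_mono[of "{..<p}" I] by simp
    then show "det (submatrix A I J) > 0" using * TP unfolding TP_mat_def by auto
  qed
  then show ?thesis by (auto simp: totally_positive_mat_def)
qed

text \<open>Places every minor of size \<open>n \<le> p\<close> inside one of size \<open>p\<close>:
  the index set is enlarged to \<open>p\<close> elements, and \<open>u\<close> records the positions
  of the old indices in it.\<close>

lemma strict_mono_extension:
  fixes x :: "nat \<Rightarrow> nat"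
  assumes x: "strict_mono_on {..<n} x" "x ` {..<n} \<subseteq> {..<d}" and "n \<le> p" "p \<le> d"
  obtains x' u where "strict_mono_on {..<p} x'" "x' ` {..<p} \<subseteq> {..<d}"
    "strict_mono_on {..<n} u" "u ` {..<n} \<subseteq> {..<p}" "\<And>i. i < n \<Longrightarrow> x i = x' (u i)"
proof -
  have "card (x ` {..<n}) = n"
    using x(1) by (simp add: card_image strict_mono_on_imp_inj_on)
  then obtain I where I: "x ` {..<n} \<subseteq> I" "I \<subseteq> {..<d}" "card I = p"
    using exists_subset_between[of "x ` {..<n}" p "{..<d}"] assms by auto
  have fin: "finite I" using I(2) finite_subset by blast
  define u where "u i = card {a \<in> I. a < x i}" for i
  have "strict_mono_on {..<p} (pick I)" using strict_mono_on_pick[OF fin] I(3) by simp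
  moreover have "pick I ` {..<p} \<subseteq> {..<d}"
    using I pick_in_set_le[of _ I] by force
  moreover have "strict_mono_on {..<n} u"
  proof (rule strict_mono_onI)
    fix i j assume ij: "i \<in> {..<n}" "j \<in> {..<n}" "i < j"
    then have "x i < x j" using x(1) by (auto simp: strict_mono_on_def)
    moreover have "x i \<in> I" using I(1) ij by auto
    ultimately have "{a \<in> I. a < x i} \<subset> {a \<in> I. a < x j}"
      by (intro psubsetI subsetI) (auto dest!: equalityD2)
    then show "u i < u j" unfolding u_def using fin by (intro psubset_card_mono) auto
  qed
  moreover have "u ` {..<n} \<subseteq> {..<p}"
  proof
    fix k assume "k \<in> u ` {..<n}"
    then obtain i where i: "i < n" "k = u i" by auto
    then have "{a \<in> I. a < x i} \<subset> I" using I(1) by auto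
    from psubset_card_mono[OF fin this] show "k \<in> {..<p}" using i(2) I(3) by (simp add: u_def)
  qed
  moreover have "x i = pick I (u i)" if "i < n" for i
    unfolding u_def using that I(1) by (subst pick_card_in_set) auto
  ultimately show thesis by (rule that)
qed

lemma TP_kernel_comp:
  assumes "TP_kernel X p K" "strict_mono_on Y u" "strict_mono_on Y v" "u ` Y \<subseteq> X" "v ` Y \<subseteq> X"
  shows "TP_kernel Y p (\<lambda>x y. K (u x) (v y))"
  unfolding TP_kernel_def
proof (intro ballI allI impI, elim conjE)
  fix n :: nat and x y
  assume *: "n \<in> {1..p}" "strict_mono_on {..<n} x" "x ` {..<n} \<subseteq> Y"
    "strict_mono_on {..<n} y" "y ` {..<n} \<subseteq> Y"
  then have "strict_mono_on {..<n} (u \<circ> x)" "strict_mono_on {..<n} (v \<circ> y)"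
    "(u \<circ> x) ` {..<n} \<subseteq> X" "(v \<circ> y) ` {..<n} \<subseteq> X"
    using assms(2-5) by (force simp: strict_mono_on_def image_subset_iff)+
  then have "det (mat n n (\<lambda>(i, j). K ((u \<circ> x) i) ((v \<circ> y) j))) > 0"
    using assms(1) *(1) unfolding TP_kernel_def by blast
  then show "det (mat n n (\<lambda>(i, j). K (u (x i)) (v (y j)))) > 0" by simp
qed

text \<open>The minors that matter have size at most \<open>p\<close>, so each sits in a
  \<open>p\<close> by \<open>p\<close> submatrix, and all minors of that submatrix are
  positive.\<close>

lemma TP_kernel_preserved_if_square_preserved:
  assumes P: "\<And>A. A \<in> carrier_mat p p \<Longrightarrow> totally_positive_mat A \<Longrightarrow> totally_positive_mat (map_mat F A)"
    and K: "TP_kernel {..<d} p K" and "p \<le> d"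
  shows "TP_kernel {..<d} p (\<lambda>i j. F (K i j))"
  unfolding TP_kernel_def
proof (intro ballI allI impI, elim conjE)
  fix n :: nat and x y :: "nat \<Rightarrow> nat"
  assume n: "n \<in> {1..p}" and x: "strict_mono_on {..<n} x" "x ` {..<n} \<subseteq> {..<d}"
    and y: "strict_mono_on {..<n} y" "y ` {..<n} \<subseteq> {..<d}"
  obtain x' u where x': "strict_mono_on {..<p} x'" "x' ` {..<p} \<subseteq> {..<d}"
    and u: "strict_mono_on {..<n} u" "u ` {..<n} \<subseteq> {..<p}" "\<And>i. i < n \<Longrightarrow> x i = x' (u i)"
    using strict_mono_extension[OF x _ \<open>p \<le> d\<close>] n by auto
  obtain y' v where y': "strict_mono_on {..<p} y'" "y' ` {..<p} \<subseteq> {..<d}"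
    and v: "strict_mono_on {..<n} v" "v ` {..<n} \<subseteq> {..<p}" "\<And>i. i < n \<Longrightarrow> y i = y' (v i)"
    using strict_mono_extension[OF y _ \<open>p \<le> d\<close>] n by auto
  let ?A = "mat p p (\<lambda>(i, j). K (x' i) (y' j))"
  have A: "?A \<in> carrier_mat p p" by simp
  have "TP_kernel {..<p} p (\<lambda>i j. K (x' i) (y' j))"
    by (rule TP_kernel_comp[OF K x'(1) y'(1) x'(2) y'(2)])
  then have "TP_kernel {..<p} p (\<lambda>i j. ?A $$ (i, j))"
    by (subst TP_kernel_cong[where K'="\<lambda>i j. K (x' i) (y' j)"]) auto
  then have "TP_mat p (map_mat F ?A)"
    using P[OF A] by (simp add: totally_positive_mat_iff_TP_mat[of _ p] TP_mat_iff_TP_kernel[of _ p])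
  then have "TP_kernel {..<p} p (\<lambda>i j. map_mat F ?A $$ (i, j))"
    by (subst (asm) TP_mat_iff_TP_kernel[of _ p]) auto
  then have "det (mat n n (\<lambda>(i, j). map_mat F ?A $$ (u i, v j))) > 0"
    using n u v unfolding TP_kernel_def by blast
  moreover have "mat n n (\<lambda>(i, j). map_mat F ?A $$ (u i, v j)) = mat n n (\<lambda>(i, j). F (K (x i) (y j)))"
    using u v by (intro eq_matI) (auto simp: image_subset_iff)
  ultimately show "det (mat n n (\<lambda>(i, j). F (K (x i) (y j)))) > 0" by simp
qed

section \<open>Sufficiency\<close>

lemma det_mat_Suc:
  fixes A :: "nat \<Rightarrow> nat \<Rightarrow> real"
  shows "det (mat (Suc n) (Suc n) (\<lambda>(i, j). A i j)) =
    (\<Sum>j<Suc n. A 0 j * ((-1) ^ j * det (mat n n (\<lambda>(i, k). A (Suc i) (if k < j then k else Suc k)))))"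
proof -
  let ?M = "mat (Suc n) (Suc n) (\<lambda>(i, j). A i j)"
  have "mat_delete ?M 0 j = mat n n (\<lambda>(i, k). A (Suc i) (if k < j then k else Suc k))" if "j < Suc n" for j
    by (rule eq_matI) (auto simp: mat_delete_def)
  then show ?thesis
    by (subst laplace_expansion_row[where i=0]) (auto simp: cofactor_def intro!: sum.cong)
qed

lemma det_mat_1: "det (mat 1 1 (\<lambda>(i, j). A i j)) = (A 0 0 :: real)"
  unfolding One_nat_def det_mat_Suc by simp

lemma det_mat_2: "det (mat 2 2 (\<lambda>(i, j). A i j)) = A 0 0 * A 1 1 - A 0 1 * (A 1 0 :: real)"
  unfolding numeral_2_eq_2 det_mat_Suc by simp

lemma det_mat_3:
  "det (mat 3 3 (\<lambda>(i, j). A i j)) =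
    A 0 0 * (A 1 1 * A 2 2 - A 1 2 * A 2 1) - A 0 1 * (A 1 0 * A 2 2 - A 1 2 * A 2 0)
    + A 0 2 * (A 1 0 * A 2 1 - A 1 1 * (A 2 0 :: real))"
  unfolding numeral_3_eq_3 det_mat_Suc by (simp add: numeral_2_eq_2 algebra_simps)

lemma TP_kernel_pos:
  assumes "TP_kernel X p K" "1 \<le> p" "x \<in> X" "y \<in> X"
  shows "K x y > 0"
proof -
  let ?x = "\<lambda>_ :: nat. x" and ?y = "\<lambda>_ :: nat. y"
  have "strict_mono_on {..<1} ?x" "strict_mono_on {..<1} ?y" "?x ` {..<1} \<subseteq> X" "?y ` {..<1} \<subseteq> X"
    "1 \<in> {1..p}"
    using assms by (auto simp: strict_mono_on_def)
  then have "det (mat 1 1 (\<lambda>(i, j). K (?x i) (?y j))) > 0"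
    using assms(1) unfolding TP_kernel_def by blast
  then show ?thesis by (simp only: det_mat_1)
qed

lemma TP_kernel_minor2:
  assumes "TP_kernel X p K" "2 \<le> p" "x \<in> X" "x' \<in> X" "y \<in> X" "y' \<in> X" "x < x'" "y < y'"
  shows "K x y' * K x' y < K x y * K x' y'"
proof -
  let ?x = "\<lambda>i :: nat. if i = 0 then x else x'" and ?y = "\<lambda>i :: nat. if i = 0 then y else y'"
  have "strict_mono_on {..<2} ?x" "strict_mono_on {..<2} ?y" "?x ` {..<2} \<subseteq> X" "?y ` {..<2} \<subseteq> X"
    "2 \<in> {1..p}"
    using assms by (auto simp: strict_mono_on_def)
  then have "det (mat 2 2 (\<lambda>(i, j). K (?x i) (?y j))) > 0"
    using assms(1) unfolding TP_kernel_def by blast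
  then show ?thesis unfolding det_mat_2 by simp
qed

text \<open>Convexity of \<open>x powr \<alpha>\<close>: chords ending at 1 get steeper as the left
  endpoint moves right. The mean value theorem compares the slopes on \<open>[u, v]\<close> and
  \<open>[v, 1]\<close>.\<close>

lemma powr_chord_mono:
  fixes u v \<alpha> :: real
  assumes "0 < u" "u \<le> v" "v < 1" "\<alpha> \<ge> 1"
  shows "(1 - u powr \<alpha>) * (1 - v) \<le> (1 - v powr \<alpha>) * (1 - u)"
proof (cases "u = v")
  case False
  then have "u < v" using assms by simp
  have der: "((\<lambda>x. x powr \<alpha>) has_real_derivative \<alpha> * x powr (\<alpha> - 1)) (at x)" if "x > 0" for x
    using that by (auto intro!: derivative_eq_intros)
  obtain r where r: "u < r" "r < v" "v powr \<alpha> - u powr \<alpha> = (v - u) * (\<alpha> * r powr (\<alpha> - 1))"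
    using MVT2[OF \<open>u < v\<close>, of "\<lambda>x. x powr \<alpha>" "\<lambda>x. \<alpha> * x powr (\<alpha> - 1)"] der assms by force
  obtain s where s: "v < s" "s < 1" "1 powr \<alpha> - v powr \<alpha> = (1 - v) * (\<alpha> * s powr (\<alpha> - 1))"
    using MVT2[OF \<open>v < 1\<close>, of "\<lambda>x. x powr \<alpha>" "\<lambda>x. \<alpha> * x powr (\<alpha> - 1)"] der assms by force
  have "r powr (\<alpha> - 1) \<le> s powr (\<alpha> - 1)" using r s assms by (intro powr_mono2) auto
  then have "(v - u) * (1 - v) * (\<alpha> * r powr (\<alpha> - 1)) \<le> (v - u) * (1 - v) * (\<alpha> * s powr (\<alpha> - 1))"
    using assms by (intro mult_left_mono) auto
  then have "(v powr \<alpha> - u powr \<alpha>) * (1 - v) \<le> (1 - v powr \<alpha>) * (v - u)"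
    using r(3) s(3) by (simp add: mult_ac)
  then show ?thesis by (simp add: algebra_simps)
qed simp

text \<open>With \<open>u = 1 / (1 + x)\<close> the elasticity of
  \<open>(1 + x) powr \<alpha> - 1\<close> is
  \<open>\<alpha> * (1 - u) / (1 - u powr \<alpha>)\<close>, a multiple of the reciprocal chord
  slope from \<open>powr_chord_mono\<close>, and \<open>u\<close> decreases in
  \<open>x\<close>.\<close>

lemma powr_elasticity_mono:
  fixes x y \<alpha> :: real
  assumes "0 < x" "x \<le> y" "\<alpha> \<ge> 1"
  shows "x * (1 + x) powr (\<alpha> - 1) * ((1 + y) powr \<alpha> - 1) \<le> y * (1 + y) powr (\<alpha> - 1) * ((1 + x) powr \<alpha> - 1)"
proof -
  have "0 < 1 / (1 + y)" "1 / (1 + y) \<le> 1 / (1 + x)" "1 / (1 + x) < 1"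
    using assms by (auto simp: field_simps)
  from powr_chord_mono[OF this assms(3)]
  have "(1 - (1 / (1 + y)) powr \<alpha>) * (1 - 1 / (1 + x)) \<le> (1 - (1 / (1 + x)) powr \<alpha>) * (1 - 1 / (1 + y))" .
  then have "((1 + y) powr \<alpha> * (1 + x) powr \<alpha>) * ((1 - (1 / (1 + y)) powr \<alpha>) * (1 - 1 / (1 + x)))
      \<le> ((1 + y) powr \<alpha> * (1 + x) powr \<alpha>) * ((1 - (1 / (1 + x)) powr \<alpha>) * (1 - 1 / (1 + y)))"
    by (intro mult_left_mono) auto
  then have "((1 + y) powr \<alpha> * (1 - (1 / (1 + y)) powr \<alpha>)) * ((1 + x) powr \<alpha> * (1 - 1 / (1 + x)))
      \<le> ((1 + x) powr \<alpha> * (1 - (1 / (1 + x)) powr \<alpha>)) * ((1 + y) powr \<alpha> * (1 - 1 / (1 + y)))"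
    by (simp only: mult_ac)
  moreover have "(1 + t) powr \<alpha> * (1 - (1 / (1 + t)) powr \<alpha>) = (1 + t) powr \<alpha> - 1"
      "(1 + t) powr \<alpha> * (1 - 1 / (1 + t)) = t * (1 + t) powr (\<alpha> - 1)" if "t > 0" for t
    using that by (simp_all add: powr_divide right_diff_distrib powr_diff field_simps)
  ultimately show ?thesis using assms by (simp only: mult_ac)
qed

text \<open>The elasticity at \<open>t * y\<close> is at least the one at \<open>t * x\<close>, so
  the quotient \<open>f y t / f x t\<close> has nonnegative derivative in \<open>t\<close>; its
  values at 1 and \<open>t\<close> are compared.\<close>

lemma powr_minus_one_ratio_mono:
  fixes x y t \<alpha> :: real
  assumes "0 < x" "x \<le> y" "1 \<le> t" "\<alpha> \<ge> 1"
  shows "((1 + t * x) powr \<alpha> - 1) * ((1 + y) powr \<alpha> - 1) \<le> ((1 + x) powr \<alpha> - 1) * ((1 + t * y) powr \<alpha> - 1)"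
proof -
  define f where "f x t = (1 + t * x) powr \<alpha> - 1" for x t :: real
  define f' where "f' x t = \<alpha> * x * (1 + t * x) powr (\<alpha> - 1)" for x t :: real
  have pos: "f z s > 0" if "z > 0" "s > 0" for z s
    using that assms(4) by (simp add: f_def gr_one_powr)
  have der: "(f z has_real_derivative f' z s) (at s)" if "z > 0" "s > 0" for z s
    using that mult_pos_pos[OF that] unfolding f_def f'_def
    by (auto intro!: derivative_eq_intros add_pos_pos simp: mult_ac)
  have "f y 1 / f x 1 \<le> f y t / f x t"
  proof (rule DERIV_nonneg_imp_nondecreasing[OF assms(3)])
    fix s :: real assume s: "1 \<le> s" "s \<le> t"
    have "((\<lambda>t. f y t / f x t) has_real_derivative (f' y s * f x s - f y s * f' x s) / (f x s * f x s)) (at s)"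
      using assms s pos[of x s] by (intro DERIV_divide der) auto
    moreover have "f' y s * f x s - f y s * f' x s \<ge> 0"
    proof -
      have "s * x * (1 + s * x) powr (\<alpha> - 1) * f y s \<le> s * y * (1 + s * y) powr (\<alpha> - 1) * f x s"
        unfolding f_def using assms s by (intro powr_elasticity_mono) auto
      \<comment> \<open>The factor \<open>\<alpha> / s\<close> converts the elasticity terms at
        \<open>s * x\<close> and \<open>s * y\<close> into derivatives in \<open>s\<close>.\<close>
      then have "(\<alpha> / s) * (s * x * (1 + s * x) powr (\<alpha> - 1) * f y s) \<le> (\<alpha> / s) * (s * y * (1 + s * y) powr (\<alpha> - 1) * f x s)"
        using assms s by (intro mult_left_mono) auto
      then show ?thesis using s by (simp add: f'_def mult_ac)
    qed
    ultimately show "\<exists>D. ((\<lambda>t. f y t / f x t) has_real_derivative D) (at s) \<and> 0 \<le> D"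
      using pos[of x s] assms s by (intro exI conjI) auto
  qed
  then show ?thesis
    using pos[of x 1] pos[of x t] assms by (simp add: f_def divide_simps mult_ac split: if_splits)
qed

text \<open>The ratio lemma with \<open>t = R / P\<close> settles the borderline value
  \<open>Q * R / P\<close> of \<open>S\<close>, where the matrix has rank one; strictness comes from
  the actual \<open>S\<close> being larger.\<close>

lemma powr_minus_one_det2_pos:
  fixes P Q R S \<alpha> :: real
  assumes "0 < P" "P \<le> Q" "P \<le> R" "0 < S" "Q * R < P * S" "\<alpha> \<ge> 1"
  shows "((1 + Q) powr \<alpha> - 1) * ((1 + R) powr \<alpha> - 1) < ((1 + P) powr \<alpha> - 1) * ((1 + S) powr \<alpha> - 1)"
proof -
  have "((1 + R / P * P) powr \<alpha> - 1) * ((1 + Q) powr \<alpha> - 1) \<le> ((1 + P) powr \<alpha> - 1) * ((1 + R / P * Q) powr \<alpha> - 1)"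
    using assms by (intro powr_minus_one_ratio_mono) auto
  also have "\<dots> < ((1 + P) powr \<alpha> - 1) * ((1 + S) powr \<alpha> - 1)"
  proof (rule mult_strict_left_mono)
    have "R / P * Q < S" using assms by (simp add: field_simps)
    moreover have "R / P * Q > 0" using assms by (intro mult_pos_pos divide_pos_pos) auto
    ultimately show "(1 + R / P * Q) powr \<alpha> - 1 < (1 + S) powr \<alpha> - 1"
      using assms by (simp add: powr_less_mono2)
    show "(1 + P) powr \<alpha> - 1 > 0" using assms by (simp add: gr_one_powr)
  qed
  finally show ?thesis using assms by (simp add: mult_ac)
qed

text \<open>Scaling the first row and column to 1 turns the 3 by 3 determinant into a 2 by 2
  determinant of the entries \<open>m i j powr \<alpha> - 1\<close>; the three 2 by 2 minors supply
  the ordering hypotheses of \<open>powr_minus_one_det2_pos\<close>.\<close>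

lemma det3_powr_pos:
  fixes k :: "nat \<Rightarrow> nat \<Rightarrow> real"
  assumes pos: "\<And>i j. i < 3 \<Longrightarrow> j < 3 \<Longrightarrow> k i j > 0"
    and min1: "k 0 1 * k 1 0 < k 0 0 * k 1 1" and min2: "k 0 2 * k 1 1 < k 0 1 * k 1 2"
    and min3: "k 1 1 * k 2 0 < k 1 0 * k 2 1"
    and det: "det (mat 3 3 (\<lambda>(i, j). k i j)) > 0" and "\<alpha> \<ge> 1"
  shows "det (mat 3 3 (\<lambda>(i, j). k i j powr \<alpha>)) > 0"
proof -
  define r where "r i = k i 0 / k 0 0" for i
  define c where "c j = k 0 j" for j
  define m where "m i j = k i j * k 0 0 / (k i 0 * k 0 j)" for i j
  have rpos: "r i > 0" if "i < 3" for i using that pos by (simp add: r_def)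
  have cpos: "c j > 0" if "j < 3" for j using that pos by (simp add: c_def)
  have mpos: "m i j > 0" if "i < 3" "j < 3" for i j using that pos by (simp add: m_def)
  have fact: "k i j = r i * c j * m i j" if "i < 3" "j < 3" for i j
    using pos[OF that] pos[of 0 j] pos[of i 0] pos[of 0 0] that by (simp add: r_def c_def m_def)
  have m1: "m 0 j = 1" "m i 0 = 1" if "i < 3" "j < 3" for i j
    using pos[of 0 j] pos[of i 0] pos[of 0 0] that by (simp_all add: m_def)
  \<comment> \<open>The exponent stays a parameter: \<open>b = 1\<close> exploits the hypothesis on
    the determinant, \<open>b = \<alpha>\<close> gives the conclusion.\<close>
  have red: "det (mat 3 3 (\<lambda>(i, j). m i j powr b)) =
      (m 1 1 powr b - 1) * (m 2 2 powr b - 1) - (m 1 2 powr b - 1) * (m 2 1 powr b - 1)" for b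
    using m1(1)[of 0 0] m1(1)[of 0 1] m1(1)[of 0 2] m1(2)[of 1 0] m1(2)[of 2 0]
    by (simp add: det_mat_3 algebra_simps)
  have "mat 3 3 (\<lambda>(i, j). k i j) = mat 3 3 (\<lambda>(i, j). r i * c j * m i j powr 1)"
    using fact mpos by (intro eq_matI) (auto simp: less_imp_le)
  with det have "(\<Prod>i<3. r i) * (\<Prod>j<3. c j) * det (mat 3 3 (\<lambda>(i, j). m i j powr 1)) > 0"
    by (simp add: det_scale_rows_cols)
  moreover have "(\<Prod>i<3. r i) * (\<Prod>j<3. c j) > 0"
    using rpos cpos by (intro mult_pos_pos prod_pos) auto
  ultimately have "det (mat 3 3 (\<lambda>(i, j). m i j powr 1)) > 0"
    by (simp add: zero_less_mult_iff)
  then have D: "(m 1 2 - 1) * (m 2 1 - 1) < (m 1 1 - 1) * (m 2 2 - 1)"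
    unfolding red using mpos by (simp add: less_imp_le)
  have P: "m 1 1 > 1" using min1 pos[of 0 0] pos[of 1 0] pos[of 0 1] by (simp add: m_def field_simps)
  have Q: "m 1 1 \<le> m 1 2"
    using min2 pos[of 0 0] pos[of 1 0] pos[of 0 1] pos[of 0 2] by (simp add: m_def field_simps)
  have R: "m 1 1 \<le> m 2 1"
    using min3 pos[of 0 0] pos[of 1 0] pos[of 0 1] pos[of 2 0] by (simp add: m_def field_simps)
  have "(m 1 2 - 1) * (m 2 1 - 1) > 0" using P Q R by simp
  with D P have S: "m 2 2 - 1 > 0" by (smt (verit) mult_pos_neg mult_nonneg_nonpos)
  have "det (mat 3 3 (\<lambda>(i, j). m i j powr \<alpha>)) > 0"
    unfolding red
    using powr_minus_one_det2_pos[of "m 1 1 - 1" "m 1 2 - 1" "m 2 1 - 1" "m 2 2 - 1" \<alpha>] P Q R S D \<open>\<alpha> \<ge> 1\<close>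
    by simp
  then have "(\<Prod>i<3. r i powr \<alpha>) * (\<Prod>j<3. c j powr \<alpha>) * det (mat 3 3 (\<lambda>(i, j). m i j powr \<alpha>)) > 0"
    using rpos cpos by (intro mult_pos_pos prod_pos) (auto simp: less_imp_neq[symmetric])
  moreover have "mat 3 3 (\<lambda>(i, j). k i j powr \<alpha>) = mat 3 3 (\<lambda>(i, j). r i powr \<alpha> * c j powr \<alpha> * m i j powr \<alpha>)"
    using fact mpos rpos cpos by (intro eq_matI) (auto simp: less_imp_le powr_mult)
  ultimately show ?thesis by (simp add: det_scale_rows_cols)
qed

section \<open>Preservation of TP kernels by the listed functions\<close>

lemma TP_kernel_scaleR:
  assumes "TP_kernel X p K" "c > 0"
  shows "TP_kernel X p (\<lambda>x y. c * K x y)"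
  unfolding TP_kernel_def
proof (intro ballI allI impI, elim conjE)
  fix n :: nat and x y
  assume *: "n \<in> {1..p}" "strict_mono_on {..<n} x" "x ` {..<n} \<subseteq> X"
    "strict_mono_on {..<n} y" "y ` {..<n} \<subseteq> X"
  then have "det (mat n n (\<lambda>(i, j). K (x i) (y j))) > 0" using assms(1) unfolding TP_kernel_def by blast
  then show "det (mat n n (\<lambda>(i, j). c * K (x i) (y j))) > 0"
    using det_scale_rows_cols[of n "\<lambda>_. c" "\<lambda>_. 1" "\<lambda>i j. K (x i) (y j)"] assms(2) by simp
qed

lemma TP_kernel_powr:
  assumes K: "TP_kernel X p K" and p: "1 \<le> p" "p \<le> 3" and \<alpha>: "0 < \<alpha>" "p = 3 \<Longrightarrow> 1 \<le> \<alpha>"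
  shows "TP_kernel X p (\<lambda>x y. K x y powr \<alpha>)"
  unfolding TP_kernel_def
proof (intro ballI allI impI, elim conjE)
  fix n :: nat and x y
  assume n: "n \<in> {1..p}" and x: "strict_mono_on {..<n} x" "x ` {..<n} \<subseteq> X"
    and y: "strict_mono_on {..<n} y" "y ` {..<n} \<subseteq> X"
  have pos: "K (x i) (y j) > 0" if "i < n" "j < n" for i j
    using TP_kernel_pos[OF K p(1)] that x(2) y(2) by blast
  have min2: "K (x i) (y j') * K (x i') (y j) < K (x i) (y j) * K (x i') (y j')"
    if "i < i'" "i' < n" "j < j'" "j' < n" for i i' j j'
    using that n x y
    by (intro TP_kernel_minor2[OF K]) (auto simp: image_subset_iff strict_mono_on_def)
  consider "n = 1" | "n = 2" | "n = 3" using n p by fastforce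
  then show "det (mat n n (\<lambda>(i, j). K (x i) (y j) powr \<alpha>)) > 0"
  proof cases
    case 1
    then show ?thesis using pos[of 0 0] by (simp only: det_mat_1) simp
  next
    case 2
    then have "(K (x 0) (y 1) * K (x 1) (y 0)) powr \<alpha> < (K (x 0) (y 0) * K (x 1) (y 1)) powr \<alpha>"
      using min2[of 0 1 0 1] pos[of 0 1] pos[of 1 0] \<alpha>(1) by (intro powr_less_mono2) auto
    then show ?thesis
      using 2 pos[of 0 1] pos[of 1 0] pos[of 0 0] pos[of 1 1] by (simp add: det_mat_2 powr_mult)
  next
    case 3
    have "det (mat n n (\<lambda>(i, j). K (x i) (y j))) > 0"
      using K n x y unfolding TP_kernel_def by blast
    then show ?thesis
      using 3 n p \<alpha>(2) pos min2[of 0 1 0 1] min2[of 0 1 1 2] min2[of 1 2 0 1]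
      by (simp only: ) (intro det3_powr_pos, auto simp: mult.commute)
  qed
qed

lemma TP_kernel_preserved:
  assumes K: "TP_kernel X p K" and p: "0 < p" and F: "TP_preserver_form p F"
  shows "TP_kernel X p (\<lambda>x y. F (K x y))"
proof -
  have pos: "K x y > 0" if "x \<in> X" "y \<in> X" for x y using TP_kernel_pos[OF K _ that] p by simp
  consider "p = 1" | "p = 2 \<or> p = 3" | "p \<ge> 4" using p by linarith
  then show ?thesis
  proof cases
    case 1
    then have "\<forall>t>0. F t > 0" using F by (simp add: TP_preserver_form_def)
    then show ?thesis
      using 1 pos unfolding TP_kernel_def
      by (auto simp: det_mat_1[unfolded One_nat_def] image_subset_iff)
  next
    case 2
    have "\<exists>c>0. \<exists>\<alpha>>0. (p = 3 \<longrightarrow> \<alpha> \<ge> 1) \<and> (\<forall>t>0. F t = c * t powr \<alpha>)"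
    proof (cases "p = 2")
      case True
      then show ?thesis using F by (simp add: TP_preserver_form_def)
    next
      case False
      then obtain c \<alpha> where "c > 0" "\<alpha> \<ge> 1" "\<forall>t>0. F t = c * t powr \<alpha>"
        using 2 F by (auto simp: TP_preserver_form_def)
      then show ?thesis by (intro exI[of _ c] exI[of _ \<alpha>] conjI) auto
    qed
    then obtain c \<alpha> where c: "c > 0" "\<alpha> > 0" "p = 3 \<Longrightarrow> \<alpha> \<ge> 1" "\<And>t. t > 0 \<Longrightarrow> F t = c * t powr \<alpha>"
      by blast
    have "TP_kernel X p (\<lambda>x y. c * K x y powr \<alpha>)"
      using 2 c by (intro TP_kernel_scaleR TP_kernel_powr K) auto
    then show ?thesis
      using c(4) pos by (subst TP_kernel_cong[where K'="\<lambda>x y. c * K x y powr \<alpha>"]) auto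
  next
    case 3
    then obtain c where c: "c > 0" "\<And>t. t > 0 \<Longrightarrow> F t = c * t"
      using F by (auto simp: TP_preserver_form_def)
    have "F (K x y) = c * K x y" if "x \<in> X" "y \<in> X" for x y
      by (rule c(2)) (rule pos[OF that])
    then show ?thesis
      by (rule TP_kernel_cong[THEN iffD2, OF _ TP_kernel_scaleR[OF K c(1)]])
  qed
qed

section \<open>The functional inequality for 2 by 2 minors\<close>

text \<open>If increments of equal length were different at two places, then the function would jump by
  a fixed amount at every point.\<close>

lemma increments_eq:
  fixes g :: "real \<Rightarrow> real"
  assumes g: "\<And>a b c d. b + c < a + d \<Longrightarrow> g b + g c < g a + g d"
  shows "g (s + k) - g s = g (t + k) - g t"
proof (rule ccontr)
  assume "g (s + k) - g s \<noteq> g (t + k) - g t"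
  \<comment> \<open>By symmetry, \<open>s\<close> is taken to be the place with the larger
    increment.\<close>
  then obtain s t where less: "g (t + k) - g t < g (s + k) - g s"
    by (metis linorder_neqE_linordered_idom)
  define D where "D = (g (s + k) - g s) - (g (t + k) - g t)"
  have "D > 0" using less by (simp add: D_def)
  have jump: "g (u + e) - g u > D" if "e > 0" for u e
  proof -
    \<comment> \<open>The point \<open>?w + k\<close> is the midpoint between \<open>u\<close> and
      \<open>u + e\<close>. The increment from \<open>?w\<close> to \<open>u + e\<close> exceeds the
      one at \<open>s\<close>, the increment from \<open>?w\<close> to \<open>u\<close> falls below
      the one at \<open>t\<close>, and their difference is \<open>g (u + e) - g u\<close>.\<close>
    let ?w = "u + e / 2 - k"
    have "g (s + k) + g ?w < g (?w + k + e / 2) + g s"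
      using that by (intro g) (simp add: field_simps)
    moreover have "g (?w + k - e / 2) + g t < g (t + k) + g ?w"
      using that by (intro g) (simp add: field_simps)
    ultimately show ?thesis by (simp add: D_def algebra_simps)
  qed
  have sum: "g (real n * e) - g 0 \<ge> real n * D" if e: "e > 0" for n e
  proof (induction n)
    case (Suc n)
    have "g (real n * e + e) - g (real n * e) > D" by (rule jump[OF e])
    moreover have "g (real (Suc n) * e) = g (real n * e + e)" "real (Suc n) * D = real n * D + D"
      by (simp_all add: distrib_right add.commute)
    ultimately show ?case using Suc by linarith
  qed simp
  \<comment> \<open>Cutting the unit interval into \<open>n\<close> steps makes \<open>g\<close>
    rise by at least \<open>n * D\<close>, too much for large \<open>n\<close>. The case
    \<open>n = 0\<close> is excluded by \<open>g 0 < g 1\<close>.\<close>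
  obtain n where n: "real n * D > g 1 - g 0" using reals_Archimedean3[OF \<open>D > 0\<close>] by blast
  moreover have "n > 0" using n g[of 0 0 1 0] by (cases n) auto
  ultimately show False using sum[of "1 / real n" n] by simp
qed

text \<open>Squeezing \<open>n * x\<close> between consecutive integers bounds
  \<open>n * \<bar>f x - f 1 * x\<bar>\<close> by \<open>f 1\<close> for every \<open>n\<close>, so
  the deviation is zero.\<close>

lemma additive_mono_imp_linear:
  fixes f :: "real \<Rightarrow> real"
  assumes add: "\<And>x y. f (x + y) = f x + f y" and mono: "\<And>x y. x \<le> y \<Longrightarrow> f x \<le> f y"
  shows "f x = f 1 * x"
proof -
  have f0: "f 0 = 0" using add[of 0 0] by simp
  have fn: "f (real n * x) = real n * f x" for n x
    by (induction n) (simp_all add: f0 add distrib_right)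
  have fm: "f (- x) = - f x" for x using add[of x "- x"] f0 by simp
  have fi: "f (of_int m) = of_int m * f 1" for m
  proof (cases "m \<ge> 0")
    case True
    then show ?thesis using fn[of "nat m" 1] by simp
  next
    case False
    then show ?thesis using fn[of "nat (- m)" 1] fm[of "of_int m"] by simp
  qed
  have f1: "f 1 \<ge> 0" using mono[of 0 1] f0 by simp
  have bound: "real n * \<bar>f x - f 1 * x\<bar> \<le> f 1" for n
  proof -
    let ?m = "\<lfloor>real n * x\<rfloor>"
    have "f (of_int ?m) \<le> f (real n * x)" "f (real n * x) \<le> f (of_int (?m + 1))"
      by (intro mono; linarith)+
    then have "of_int ?m * f 1 \<le> real n * f x" "real n * f x \<le> (of_int ?m + 1) * f 1"
      unfolding fi fn by simp_all
    moreover have "of_int ?m * f 1 \<le> real n * x * f 1" "real n * x * f 1 \<le> (of_int ?m + 1) * f 1"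
      using f1 by (intro mult_right_mono; linarith)+
    ultimately have "\<bar>real n * f x - real n * x * f 1\<bar> \<le> f 1" by (simp add: algebra_simps abs_le_iff)
    moreover have "real n * f x - real n * x * f 1 = real n * (f x - f 1 * x)" by (simp add: algebra_simps)
    ultimately show ?thesis by (simp add: abs_mult)
  qed
  show ?thesis
  proof (rule ccontr)
    assume "f x \<noteq> f 1 * x"
    then have "\<bar>f x - f 1 * x\<bar> > 0" by simp
    then obtain n where "real n * \<bar>f x - f 1 * x\<bar> > f 1" using reals_Archimedean3 by blast
    with bound[of n] show False by simp
  qed
qed

text \<open>In logarithmic coordinates the products become sums; \<open>increments_eq\<close> makes
  \<open>g - g 0\<close> additive, and monotonicity makes it linear with slope
  \<open>\<alpha>\<close>.\<close>

lemma power_function_if_strict_cross_ratio_mono: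
  fixes F :: "real \<Rightarrow> real"
  assumes pos: "\<And>x. x > 0 \<Longrightarrow> F x > 0"
    and F: "\<And>a b c d. a > 0 \<Longrightarrow> b > 0 \<Longrightarrow> c > 0 \<Longrightarrow> d > 0 \<Longrightarrow> b * c < a * d \<Longrightarrow> F b * F c < F a * F d"
  shows "\<exists>c>0. \<exists>\<alpha>>0. \<forall>x>0. F x = c * x powr \<alpha>"
proof -
  define g where "g t = ln (F (exp t))" for t
  have g: "g b + g c < g a + g d" if "b + c < a + d" for a b c d
  proof -
    have "F (exp b) * F (exp c) < F (exp a) * F (exp d)"
      using that by (intro F) (simp_all flip: exp_add)
    then have "ln (F (exp b) * F (exp c)) < ln (F (exp a) * F (exp d))"
      by (subst ln_less_cancel_iff) (simp_all add: pos)
    then show ?thesis using pos[of "exp _"] by (simp add: g_def ln_mult less_imp_neq[symmetric])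
  qed
  define f where "f t = g t - g 0" for t
  have mono: "g x < g y" if "x < y" for x y using g[of x 0 y 0] that by simp
  have "f t = f 1 * t" for t
  proof (rule additive_mono_imp_linear)
    fix x y show "f (x + y) = f x + f y" using increments_eq[of g x y 0] g by (simp add: f_def)
  next
    fix x y :: real assume "x \<le> y" then show "f x \<le> f y"
      using mono[of x y] by (cases "x = y") (auto simp: f_def)
  qed
  then have lin: "g t = g 0 + f 1 * t" for t by (metis f_def add_diff_cancel_left' diff_add_cancel add.commute)
  have "F x = exp (g 0) * x powr f 1" if "x > 0" for x
  proof -
    have "F x = exp (g (ln x))" using that pos by (simp add: g_def)
    also have "\<dots> = exp (g 0) * x powr f 1" using that unfolding lin[of "ln x"] by (simp add: exp_add powr_def)
    finally show ?thesis .
  qed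
  moreover have "f 1 > 0" using mono[of 0 1] by (simp add: f_def)
  ultimately show ?thesis by (metis exp_gt_zero)
qed

section \<open>Small perturbations of the all-ones matrix\<close>

text \<open>A polynomial in nine reals, so that limits and factorizations can be computed without
  matrices.\<close>

definition det3 :: "real \<Rightarrow> real \<Rightarrow> real \<Rightarrow> real \<Rightarrow> real \<Rightarrow> real \<Rightarrow> real \<Rightarrow> real \<Rightarrow> real \<Rightarrow> real" where
  "det3 a0 a1 a2 b0 b1 b2 c0 c1 c2 =
    a0 * (b1 * c2 - b2 * c1) - a1 * (b0 * c2 - b2 * c0) + a2 * (b0 * c1 - b1 * c0)"

text \<open>The Taylor remainder after the linear term, divided by \<open>e\<^sup>2\<close> so that
  it converges as \<open>e\<close> tends to 0 from above.\<close>

definition powr_rem :: "real \<Rightarrow> real \<Rightarrow> real \<Rightarrow> real" where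
  "powr_rem \<alpha> e t = ((1 + e * t) powr \<alpha> - 1 - \<alpha> * (e * t)) / e\<^sup>2"

lemma powr_eq_powr_rem:
  assumes "e \<noteq> 0"
  shows "(1 + e * t) powr \<alpha> = 1 + e * (\<alpha> * t + e * powr_rem \<alpha> e t)"
proof -
  have "e\<^sup>2 * powr_rem \<alpha> e t = (1 + e * t) powr \<alpha> - 1 - \<alpha> * (e * t)"
    using assms by (simp add: powr_rem_def)
  then show ?thesis by (simp add: power2_eq_square algebra_simps)
qed

lemma tendsto_powr_rem:
  fixes \<alpha> t :: real
  assumes "\<alpha> > 0" "t > 0"
  shows "((\<lambda>e. powr_rem \<alpha> e t) \<longlongrightarrow> \<alpha> * (\<alpha> - 1) / 2 * t\<^sup>2) (at_right 0)"
proof -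
  have "((\<lambda>e. powr_rem \<alpha> e t) \<longlongrightarrow> t * (t * ((\<alpha> - 1) * \<alpha>)) / 2) (at_right 0)"
    unfolding powr_rem_def using assms by real_asymp
  then show ?thesis by (simp add: power2_eq_square mult_ac)
qed

lemma eventually_at_right_neg_imp_ex:
  fixes f :: "real \<Rightarrow> real"
  assumes "(f \<longlongrightarrow> l) (at_right 0)" "l < 0"
  obtains e where "e > 0" "f e < 0"
proof -
  have "eventually (\<lambda>e. f e < 0 \<and> e > 0) (at_right 0)"
    using order_tendstoD(2)[OF assms] by (intro eventually_conj) (auto simp: eventually_at_right_less)
  then have "\<exists>e. f e < 0 \<and> e > 0"
    by (intro eventually_happens'[OF trivial_limit_at_right_real])
  with that show thesis by blast
qed

text \<open>This is the leading 3 by 3 minor after clearing the row and column of ones. Since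
  \<open>1 * 4 = 2 * 2\<close>, the terms of order \<open>e ^ 2\<close> cancel, and the limiting
  coefficient of \<open>e ^ 3\<close> is
  \<open>2 * \<alpha>\<^sup>2 * (\<alpha> - 1)\<close>.\<close>

lemma powr_minor3_neg:
  fixes \<alpha> :: real
  assumes "0 < \<alpha>" "\<alpha> < 1"
  obtains e where "e > 0"
    "((1 + e * 1) powr \<alpha> - 1) * ((1 + e * 4) powr \<alpha> - 1) - ((1 + e * 2) powr \<alpha> - 1)\<^sup>2 < 0"
proof -
  let ?g = "powr_rem \<alpha>"
  let ?b = "\<alpha> * (\<alpha> - 1) / 2"
  let ?f = "\<lambda>e. \<alpha> * ?g e 4 + 4 * \<alpha> * ?g e 1 - 4 * \<alpha> * ?g e 2 + e * (?g e 1 * ?g e 4 - (?g e 2)\<^sup>2)"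
  have lim: "(?f \<longlongrightarrow> \<alpha> * (?b * 4\<^sup>2) + 4 * \<alpha> * (?b * 1\<^sup>2) - 4 * \<alpha> * (?b * 2\<^sup>2) +
      0 * ((?b * 1\<^sup>2) * (?b * 4\<^sup>2) - (?b * 2\<^sup>2)\<^sup>2)) (at_right 0)"
    using assms by (intro tendsto_intros tendsto_powr_rem) auto
  have eq: "\<alpha> * (?b * 4\<^sup>2) + 4 * \<alpha> * (?b * 1\<^sup>2) - 4 * \<alpha> * (?b * 2\<^sup>2) +
      0 * ((?b * 1\<^sup>2) * (?b * 4\<^sup>2) - (?b * 2\<^sup>2)\<^sup>2) = 2 * \<alpha>\<^sup>2 * (\<alpha> - 1)"
    by (simp add: power2_eq_square field_simps)
  have "2 * \<alpha>\<^sup>2 * (\<alpha> - 1) < 0"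
    using assms by (intro mult_pos_neg) auto
  then obtain e where e: "e > 0" "?f e < 0"
    by (rule eventually_at_right_neg_imp_ex[OF lim[unfolded eq]])
  have e0: "e \<noteq> 0" using e(1) by simp
  have "((1 + e * 1) powr \<alpha> - 1) * ((1 + e * 4) powr \<alpha> - 1) - ((1 + e * 2) powr \<alpha> - 1)\<^sup>2 = e ^ 3 * ?f e"
    unfolding powr_eq_powr_rem[OF e0] by (simp add: power2_eq_square power3_eq_cube algebra_simps)
  also have "\<dots> < 0" using e by (intro mult_pos_neg) auto
  finally show thesis using that e(1) by blast
qed

text \<open>Subtracting twice the first row from the second leaves only terms of order
  \<open>e ^ 2\<close> there, which accounts for the fourth power.\<close>

lemma det3_two_near_proportional_rows:
  "det3 (e * (a + e * p0)) (e * (a + e * p1)) (e * (a + e * p2))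
        (e * (2 * a + e * q0)) (e * (2 * a + e * q1)) (e * (2 * a + e * q2))
        (e * r0) (e * r1) (e * r2) =
   e ^ 4 * det3 (a + e * p0) (a + e * p1) (a + e * p2)
        (q0 - 2 * p0) (q1 - 2 * p1) (q2 - 2 * p2) r0 r1 r2"
  by (simp add: det3_def power4_eq_xxxx algebra_simps)

text \<open>For the matrix \<open>1 + e (i j + (i - 2)\<^sub>+ (j - 2)\<^sub>+)\<close> with rows 0 to 3 and columns 1 to 4,
  the first order parts of the differenced rows are \<open>(1, 1, 1)\<close>, \<open>(2, 2, 2)\<close>, \<open>(3, 4, 4)\<close>. Two of them are
  proportional, so the terms of order \<open>e ^ 3\<close> cancel and the second order decides the sign.\<close>

lemma powr_minor4_neg:
  fixes \<alpha> :: real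
  assumes "\<alpha> > 1"
  obtains e where "e > 0"
    "let f = (\<lambda>t. (1 + e * t) powr \<alpha>) in
      det3 (f 2 - f 1) (f 3 - f 2) (f 4 - f 3) (f 4 - f 2) (f 6 - f 4) (f 8 - f 6)
           (f 6 - f 3) (f 10 - f 6) (f 14 - f 10) < 0"
proof -
  let ?g = "powr_rem \<alpha>"
  let ?b = "\<lambda>t. \<alpha> * (\<alpha> - 1) / 2 * t\<^sup>2"
  let ?h = "\<lambda>e. det3 (\<alpha> + e * (?g e 2 - ?g e 1)) (\<alpha> + e * (?g e 3 - ?g e 2)) (\<alpha> + e * (?g e 4 - ?g e 3))
        ((?g e 4 - ?g e 2) - 2 * (?g e 2 - ?g e 1)) ((?g e 6 - ?g e 4) - 2 * (?g e 3 - ?g e 2))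
        ((?g e 8 - ?g e 6) - 2 * (?g e 4 - ?g e 3))
        (3 * \<alpha> + e * (?g e 6 - ?g e 3)) (4 * \<alpha> + e * (?g e 10 - ?g e 6)) (4 * \<alpha> + e * (?g e 14 - ?g e 10))"
  let ?l = "det3 (\<alpha> + 0 * (?b 2 - ?b 1)) (\<alpha> + 0 * (?b 3 - ?b 2)) (\<alpha> + 0 * (?b 4 - ?b 3))
        ((?b 4 - ?b 2) - 2 * (?b 2 - ?b 1)) ((?b 6 - ?b 4) - 2 * (?b 3 - ?b 2))
        ((?b 8 - ?b 6) - 2 * (?b 4 - ?b 3))
        (3 * \<alpha> + 0 * (?b 6 - ?b 3)) (4 * \<alpha> + 0 * (?b 10 - ?b 6)) (4 * \<alpha> + 0 * (?b 14 - ?b 10))"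
  have lim: "(?h \<longlongrightarrow> ?l) (at_right 0)"
    unfolding det3_def using assms by (intro tendsto_intros tendsto_powr_rem) auto
  \<comment> \<open>As \<open>?b t\<close> is proportional to the square of \<open>t\<close>, the
    middle row is \<open>\<alpha> * (\<alpha> - 1)\<close> times \<open>(3, 5, 7)\<close>; the
    determinant with rows \<open>(1, 1, 1)\<close>, \<open>(3, 5, 7)\<close>,
    \<open>(3, 4, 4)\<close> is -2.\<close>
  have eq: "?l = - 2 * (\<alpha> ^ 3 * (\<alpha> - 1))"
    by (simp add: det3_def power2_eq_square power3_eq_cube field_simps)
  have "- 2 * (\<alpha> ^ 3 * (\<alpha> - 1)) < 0" using assms by simp
  then obtain e where e: "e > 0" "?h e < 0"
    by (rule eventually_at_right_neg_imp_ex[OF lim[unfolded eq]])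
  have e0: "e \<noteq> 0" using e(1) by simp
  define f where "f t = (1 + e * t) powr \<alpha>" for t
  have diff: "f s - f t = e * (\<alpha> * (s - t) + e * (?g e s - ?g e t))" for s t
    unfolding f_def powr_eq_powr_rem[OF e0] by (simp add: algebra_simps)
  have "det3 (f 2 - f 1) (f 3 - f 2) (f 4 - f 3) (f 4 - f 2) (f 6 - f 4) (f 8 - f 6)
           (f 6 - f 3) (f 10 - f 6) (f 14 - f 10) = e ^ 4 * ?h e"
    unfolding diff det3_two_near_proportional_rows[symmetric] by (simp add: mult.commute)
  also have "\<dots> < 0" using e by (intro mult_pos_neg) auto
  finally show thesis using that[OF e(1)] by (simp add: Let_def f_def)
qed

section \<open>Necessity\<close>

lemma exists_strict_mono_into:
  fixes X :: "'a::linorder set"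
  assumes "infinite X \<or> N \<le> card X"
  obtains z :: "nat \<Rightarrow> 'a" where "strict_mono_on {..<N} z" "z ` {..<N} \<subseteq> X"
proof -
  obtain Y where Y: "Y \<subseteq> X" "card Y = N" "finite Y"
    using assms by (meson infinite_arbitrarily_large obtain_subset_with_card_n)
  let ?z = "\<lambda>i. sorted_list_of_set Y ! i"
  have len: "length (sorted_list_of_set Y) = N" using Y by simp
  have "strict_mono_on {..<N} ?z"
    using len sorted_wrt_nth_less[OF strict_sorted_list_of_set[of Y]]
    by (auto simp: strict_mono_on_def)
  moreover have "?z i \<in> Y" if "i < N" for i
    using nth_mem[of i "sorted_list_of_set Y"] that len Y(3) by simp
  then have "?z ` {..<N} \<subseteq> X" using Y(1) by auto
  ultimately show thesis by (rule that)
qed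

text \<open>The 2 by 2 minors make the ratio of two columns strictly increasing. The embedding is
  what allows exponential kernels to be built on an arbitrary \<open>X\<close>.\<close>

lemma TP_kernel_imp_order_embedding:
  fixes X :: "'a::linorder set"
  assumes K: "TP_kernel X p K" "2 \<le> p" and X: "infinite X \<or> 2 \<le> card X"
  obtains \<phi> :: "'a \<Rightarrow> real" where "strict_mono_on X \<phi>"
proof -
  obtain z :: "nat \<Rightarrow> 'a" where z: "strict_mono_on {..<2} z" "z ` {..<2} \<subseteq> X"
    using exists_strict_mono_into[OF X] by blast
  have mem: "z 0 \<in> X" "z 1 \<in> X" and less: "z 0 < z 1"
    using z by (auto simp: strict_mono_on_def)
  have "strict_mono_on X (\<lambda>x. K x (z 1) / K x (z 0))"
  proof (rule strict_mono_onI)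
    fix x y assume xy: "x \<in> X" "y \<in> X" "x < y"
    have "K x (z 1) * K y (z 0) < K x (z 0) * K y (z 1)"
      by (rule TP_kernel_minor2[OF K xy(1,2) mem xy(3) less])
    moreover have "K x (z 0) > 0" "K y (z 0) > 0"
      using TP_kernel_pos[OF K(1)] K(2) xy mem by auto
    ultimately show "K x (z 1) / K x (z 0) < K y (z 1) / K y (z 0)"
      by (simp add: field_simps)
  qed
  then show thesis by (rule that)
qed

text \<open>Weights only scale rows and columns of the exponential kernel; they are the free
  parameters for prescribing entries.\<close>

lemma TP_kernel_weighted_exp:
  fixes \<phi> :: "'a::linorder \<Rightarrow> real"
  assumes \<phi>: "strict_mono_on X \<phi>" and w: "\<And>x. x \<in> X \<Longrightarrow> w x > 0" and "\<mu> > 0"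
  shows "TP_kernel X p (\<lambda>x y. w x * w y * exp (\<mu> * \<phi> x * \<phi> y))"
  unfolding TP_kernel_def
proof (intro ballI allI impI, elim conjE)
  fix n :: nat and x y
  assume *: "strict_mono_on {..<n} x" "x ` {..<n} \<subseteq> X" "strict_mono_on {..<n} y" "y ` {..<n} \<subseteq> X"
  have "det (mat n n (\<lambda>(i, j). exp ((\<mu> * \<phi> (x i)) * \<phi> (y j)))) > 0"
    by (rule det_exp_pos) (use * \<phi> \<open>\<mu> > 0\<close> in \<open>auto simp: strict_mono_on_def image_subset_iff\<close>)
  moreover have "(\<Prod>i<n. w (x i)) > 0" "(\<Prod>j<n. w (y j)) > 0"
    using * w by (auto intro!: prod_pos)
  ultimately show "det (mat n n (\<lambda>(i, j). w (x i) * w (y j) * exp (\<mu> * \<phi> (x i) * \<phi> (y j)))) > 0"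
    unfolding det_scale_rows_cols by simp
qed

lemma power_function_if_TP_preserver:
  fixes X :: "'a::linorder set"
  assumes \<phi>: "strict_mono_on X (\<phi> :: 'a \<Rightarrow> real)" and X: "infinite X \<or> 3 \<le> card X" and p: "2 \<le> p"
    and F: "\<And>K. symmetric_kernel X K \<Longrightarrow> TP_kernel X p K \<Longrightarrow> TP_kernel X p (\<lambda>x y. F (K x y))"
  shows "\<exists>c>0. \<exists>\<alpha>>0. \<forall>x>0. F x = c * x powr \<alpha>"
proof -
  obtain z :: "nat \<Rightarrow> 'a" where z: "strict_mono_on {..<3} z" "z ` {..<3} \<subseteq> X"
    using exists_strict_mono_into[OF X] by blast
  have mem: "z 0 \<in> X" "z 1 \<in> X" "z 2 \<in> X" and less: "z 0 < z 1" "z 1 < z 2"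
    using z by (auto simp: strict_mono_on_def)
  have \<phi>_less: "\<phi> (z 0) < \<phi> (z 1)" "\<phi> (z 1) < \<phi> (z 2)"
    using \<phi> mem less by (auto simp: strict_mono_on_def)
  have sym: "symmetric_kernel X (\<lambda>x y. w x * w y * exp (\<mu> * \<phi> x * \<phi> y))" for w and \<mu> :: real
    by (simp add: symmetric_kernel_def mult_ac)
  have pos: "F t > 0" if "t > 0" for t
  proof -
    \<comment> \<open>A constant weight that makes the kernel equal to \<open>t\<close> at
      \<open>(z 0, z 0)\<close>.\<close>
    let ?w = "\<lambda>_. sqrt (t / exp (\<phi> (z 0) * \<phi> (z 0)))"
    have "TP_kernel X p (\<lambda>x y. F (?w x * ?w y * exp (1 * \<phi> x * \<phi> y)))"
      using that by (intro F sym TP_kernel_weighted_exp \<phi>) auto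
    from TP_kernel_pos[OF this _ mem(1) mem(1)] p that show ?thesis by simp
  qed
  have cross: "F b * F c < F a * F d"
    if "a > 0" "b > 0" "c > 0" "d > 0" and bc: "b * c < a * d" for a b c d
  proof -
    let ?f0 = "\<phi> (z 0)" and ?f1 = "\<phi> (z 1)" and ?f2 = "\<phi> (z 2)"
    \<comment> \<open>This \<open>\<mu>\<close> makes the cross ratio of the block equal to
      \<open>a * d / (b * c)\<close>, which exceeds 1, so \<open>\<mu>\<close> is positive.\<close>
    define \<mu> where "\<mu> = ln (a * d / (b * c)) / ((?f2 - ?f1) * (?f1 - ?f0))"
    have "1 < a * d / (b * c)" using that by simp
    then have "\<mu> > 0" using \<phi>_less by (auto simp: \<mu>_def intro!: divide_pos_pos mult_pos_pos)
    have \<mu>_eq: "exp (\<mu> * ((?f2 - ?f1) * (?f1 - ?f0))) = a * d / (b * c)"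
      using \<phi>_less that by (simp add: \<mu>_def)
    \<comment> \<open>The weights prescribe \<open>c\<close> at \<open>(z 1, z 1)\<close>,
      \<open>a\<close> at \<open>(z 0, z 1)\<close> and \<open>d\<close> at
      \<open>(z 1, z 2)\<close>; the corner \<open>b\<close> at \<open>(z 0, z 2)\<close> then
      follows from the cross ratio.\<close>
    define w1 where "w1 = sqrt (c / exp (\<mu> * ?f1 * ?f1))"
    define w0 where "w0 = a / (w1 * exp (\<mu> * ?f0 * ?f1))"
    define w2 where "w2 = d / (w1 * exp (\<mu> * ?f1 * ?f2))"
    have wpos: "w0 > 0" "w1 > 0" "w2 > 0" using that by (auto simp: w0_def w1_def w2_def)
    define w where "w x = (if x = z 0 then w0 else if x = z 1 then w1 else w2)" for x
    have wz: "w (z 0) = w0" "w (z 1) = w1" "w (z 2) = w2" using less by (auto simp: w_def)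
    let ?K = "\<lambda>x y. w x * w y * exp (\<mu> * \<phi> x * \<phi> y)"
    have K: "?K (z 0) (z 1) = a" "?K (z 1) (z 2) = d"
      using wpos unfolding wz by (simp_all add: w0_def w2_def mult_ac)
    have w1sq: "w1 * w1 = c / exp (\<mu> * ?f1 * ?f1)"
      using that by (simp add: w1_def)
    then have K11: "?K (z 1) (z 1) = c" unfolding wz by simp
    have "?K (z 0) (z 2) * exp (\<mu> * ((?f2 - ?f1) * (?f1 - ?f0))) * ?K (z 1) (z 1) = ?K (z 0) (z 1) * ?K (z 1) (z 2)"
      by (simp add: algebra_simps flip: exp_add)
    then have "?K (z 0) (z 2) * (a * d / (b * c)) * c = a * d"
      unfolding K K11 \<mu>_eq .
    then have K02: "?K (z 0) (z 2) = b" using that by (simp add: field_simps)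
    have "TP_kernel X p ?K"
      using wpos \<open>\<mu> > 0\<close> by (intro TP_kernel_weighted_exp \<phi>) (auto simp: w_def)
    then have "TP_kernel X p (\<lambda>x y. F (?K x y))" by (intro F sym)
    from TP_kernel_minor2[OF this p mem(1,2,2,3) less]
    show ?thesis unfolding K K11 K02 .
  qed
  show ?thesis by (rule power_function_if_strict_cross_ratio_mono[OF pos cross])
qed

text \<open>A Gaussian of shrinking width restricted to the nodes \<open>z\<close> tends to the identity matrix, so
  column operations and weights prescribe the limit of the Gram matrix on the nodes.\<close>

definition gauss :: "('a \<Rightarrow> real) \<Rightarrow> (nat \<Rightarrow> 'a) \<Rightarrow> real \<Rightarrow> 'a \<Rightarrow> nat \<Rightarrow> real" where
  "gauss \<phi> z t x k = exp (- t * (\<phi> x - \<phi> (z k))\<^sup>2)"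

text \<open>On the nodes and for large \<open>t\<close>, the first suffix sums approach step
  functions. The second ones, which spare column 0, approach truncated linear functions and keep the
  constant.\<close>

definition spline :: "('a \<Rightarrow> real) \<Rightarrow> (nat \<Rightarrow> 'a) \<Rightarrow> nat \<Rightarrow> real \<Rightarrow> 'a \<Rightarrow> nat \<Rightarrow> real" where
  "spline \<phi> z N t x k =
    (let S = (\<lambda>k. \<Sum>l\<in>{k..<N}. gauss \<phi> z t x l) in if 1 \<le> k then \<Sum>l\<in>{k..<N}. S l else S k)"

text \<open>On the nodes, columns 0, 1 and 3 tend to 1, \<open>i\<close> and the truncated
  \<open>i - 2\<close>, the ingredients of the target matrix. The weight \<open>1 / t\<close> lets
  the other columns fade while staying positive, as \<open>TP_kernel_Gram\<close> requires.\<close>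

definition spline_kernel ::
    "('a \<Rightarrow> real) \<Rightarrow> (nat \<Rightarrow> 'a) \<Rightarrow> nat \<Rightarrow> real \<Rightarrow> real \<Rightarrow> 'a \<Rightarrow> 'a \<Rightarrow> real" where
  "spline_kernel \<phi> z N e t x y =
    (\<Sum>k<N. (if k = 0 then 1 else if k = 1 \<or> k = 3 then e else 1 / t) * spline \<phi> z N t x k * spline \<phi> z N t y k)"

text \<open>Expanding the square splits the Gaussian into a row factor, a column factor and
  \<open>exp (\<phi> x * (2 * t * \<phi> (z k)))\<close>.\<close>

lemma TP_family_gauss:
  assumes \<phi>: "strict_mono_on X \<phi>" and z: "strict_mono_on {..<N} z" "z ` {..<N} \<subseteq> X" and "t > 0"
  shows "TP_family X N (gauss \<phi> z t)"
proof -
  have "strict_mono_on {..<N} (\<lambda>k. 2 * t * \<phi> (z k))"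
    using \<phi> z \<open>t > 0\<close> by (auto simp: strict_mono_on_def image_subset_iff)
  from TP_family_scale[OF TP_family_exp[OF \<phi> this],
      of "\<lambda>x. exp (- t * (\<phi> x)\<^sup>2)" "\<lambda>k. exp (- t * (\<phi> (z k))\<^sup>2)"]
  have "TP_family X N (\<lambda>x k. exp (- t * (\<phi> x)\<^sup>2) * exp (- t * (\<phi> (z k))\<^sup>2) * exp (\<phi> x * (2 * t * \<phi> (z k))))"
    by simp
  then show ?thesis
    by (rule TP_family_cong) (simp add: gauss_def power2_eq_square algebra_simps flip: exp_add)
qed

lemma TP_family_spline:
  assumes "strict_mono_on X \<phi>" "strict_mono_on {..<N} z" "z ` {..<N} \<subseteq> X" "t > 0" "1 \<le> N"
  shows "TP_family X N (spline \<phi> z N t)"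
  using TP_family_cumulative[OF TP_family_cumulative[OF TP_family_gauss[OF assms(1-4)], of 0] assms(5)]
  by (rule TP_family_cong) (simp_all add: spline_def Let_def)

lemma TP_kernel_spline_kernel:
  assumes "strict_mono_on X \<phi>" "strict_mono_on {..<N} z" "z ` {..<N} \<subseteq> X" "t > 0" "e > 0" "1 \<le> N" "p \<le> N"
  shows "TP_kernel X p (spline_kernel \<phi> z N e t)"
proof -
  have "TP_family X N (spline \<phi> z N t)" by (rule TP_family_spline[OF assms(1-4,6)])
  from TP_kernel_Gram[OF this _ assms(7), of "\<lambda>k. if k = 0 then 1 else if k = 1 \<or> k = 3 then e else 1 / t"]
  show ?thesis unfolding spline_kernel_def using assms by simp
qed

lemma symmetric_spline_kernel: "symmetric_kernel X (spline_kernel \<phi> z N e t)"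
  by (simp add: symmetric_kernel_def spline_kernel_def mult_ac)

lemma tendsto_gauss_node:
  assumes "inj_on (\<phi> \<circ> z) {..<N}" "i < N" "l < N"
  shows "((\<lambda>t. gauss \<phi> z t (z i) l) \<longlongrightarrow> of_bool (i = l)) at_top"
proof (cases "i = l")
  case False
  define D where "D = (\<phi> (z i) - \<phi> (z l))\<^sup>2"
  have "D > 0" using assms False by (auto simp: D_def inj_on_def)
  then have "((\<lambda>t. exp (- t * D)) \<longlongrightarrow> 0) at_top" by real_asymp
  then show ?thesis using False by (simp add: gauss_def D_def)
qed (simp add: gauss_def)

text \<open>The subtraction is truncated, so the limit of column \<open>k \<ge> 1\<close> is the linear spline with
  knot \<open>k - 1\<close>.\<close>

lemma tendsto_spline_node:
  assumes "inj_on (\<phi> \<circ> z) {..<N}" "i < N" "k < N"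
  shows "((\<lambda>t. spline \<phi> z N t (z i) k) \<longlongrightarrow> (if k = 0 then 1 else real (Suc i - k))) at_top"
proof -
  have S: "((\<lambda>t. \<Sum>l\<in>{k..<N}. gauss \<phi> z t (z i) l) \<longlongrightarrow> of_bool (k \<le> i)) at_top" for k
  proof -
    have "((\<lambda>t. \<Sum>l\<in>{k..<N}. gauss \<phi> z t (z i) l) \<longlongrightarrow> (\<Sum>l\<in>{k..<N}. of_bool (i = l))) at_top"
      using assms by (intro tendsto_sum tendsto_gauss_node) auto
    moreover have "(\<Sum>l\<in>{k..<N}. of_bool (i = l)) = (of_bool (k \<le> i) :: real)"
      using assms(2) by (subst of_bool_def, subst sum.delta') auto
    ultimately show ?thesis by simp
  qed
  show ?thesis
  proof (cases "k = 0")
    case True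
    then show ?thesis using S[of 0] by (simp add: spline_def)
  next
    case False
    have "((\<lambda>t. \<Sum>l\<in>{k..<N}. \<Sum>l\<in>{l..<N}. gauss \<phi> z t (z i) l) \<longlongrightarrow> (\<Sum>l\<in>{k..<N}. of_bool (l \<le> i))) at_top"
      by (intro tendsto_sum S)
    moreover have "(\<Sum>l\<in>{k..<N}. of_bool (l \<le> i)) = real (Suc i - k)"
    proof -
      have "{l \<in> {k..<N}. l \<le> i} = {k..i}" using assms(2) by auto
      then show ?thesis by (simp add: sum.If_cases of_bool_def Int_def)
    qed
    ultimately show ?thesis using False by (simp add: spline_def)
  qed
qed

lemma tendsto_spline_kernel_nodes:
  assumes inj: "inj_on (\<phi> \<circ> z) {..<N}" and "i < N" "j < N" "4 \<le> N"
  shows "((\<lambda>t. spline_kernel \<phi> z N e t (z i) (z j)) \<longlongrightarrow> 1 + e * real (i * j + (i - 2) * (j - 2))) at_top"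
proof -
  let ?w = "\<lambda>k. if k = 0 then 1 else if k = 1 \<or> k = 3 then e else 0"
  let ?s = "\<lambda>i k. if k = 0 then 1 else real (Suc i - k)"
  have w: "((\<lambda>t. if k = 0 then 1 else if k = 1 \<or> k = 3 then e else 1 / t) \<longlongrightarrow> ?w k) at_top" for k :: nat
  proof -
    have "((\<lambda>t::real. 1 / t) \<longlongrightarrow> 0) at_top" by real_asymp
    then show ?thesis by simp
  qed
  have "((\<lambda>t. spline_kernel \<phi> z N e t (z i) (z j)) \<longlongrightarrow> (\<Sum>k<N. ?w k * ?s i k * ?s j k)) at_top"
    unfolding spline_kernel_def
    by (intro tendsto_sum tendsto_mult w tendsto_spline_node[OF inj] assms) auto
  moreover have "(\<Sum>k<N. ?w k * ?s i k * ?s j k) = (\<Sum>k\<in>{0, 1, 3}. ?w k * ?s i k * ?s j k)"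
    using \<open>4 \<le> N\<close> by (intro sum.mono_neutral_right) auto
  moreover have "\<dots> = 1 + e * real (i * j + (i - 2) * (j - 2))"
    by (simp add: numeral_3_eq_3 numeral_2_eq_2 distrib_left)
  ultimately show ?thesis by simp
qed

lemma tendsto_det:
  fixes M :: "'b \<Rightarrow> nat \<Rightarrow> nat \<Rightarrow> real"
  assumes "\<And>i j. i < n \<Longrightarrow> j < n \<Longrightarrow> ((\<lambda>t. M t i j) \<longlongrightarrow> L i j) G"
  shows "((\<lambda>t. det (mat n n (\<lambda>(i, j). M t i j))) \<longlongrightarrow> det (mat n n (\<lambda>(i, j). L i j))) G"
proof -
  have det: "det (mat n n (\<lambda>(i, j). A i j)) =
      (\<Sum>p\<in>{p. p permutes {0..<n}}. signof p * (\<Prod>i=0..<n. A i (p i)))" for A :: "nat \<Rightarrow> nat \<Rightarrow> real"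
    by (subst det_def'[where n=n]) (auto intro!: sum.cong prod.cong simp: permutes_in_image)
  show ?thesis
    unfolding det
    by (intro tendsto_sum tendsto_mult tendsto_const tendsto_prod assms) (auto simp: permutes_in_image)
qed

text \<open>For each \<open>t > 0\<close> the minor of the transformed spline kernel is positive.
  The limit in \<open>t\<close> leaves only a weak inequality, which still excludes a strictly
  negative minor.\<close>

lemma spline_minor_nonneg:
  fixes X :: "'a::linorder set"
  assumes \<phi>: "strict_mono_on X (\<phi> :: 'a \<Rightarrow> real)" and X: "infinite X \<or> p + 1 \<le> card X" and p: "3 \<le> p"
    and F: "\<And>K. symmetric_kernel X K \<Longrightarrow> TP_kernel X p K \<Longrightarrow> TP_kernel X p (\<lambda>x y. F (K x y))"
    and c: "c > 0" and \<alpha>: "\<alpha> > 0" and F_eq: "\<And>x. x > 0 \<Longrightarrow> F x = c * x powr \<alpha>"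
    and e: "e > 0" and n: "1 \<le> n" "n \<le> p"
    and r: "strict_mono_on {..<n} r" "r ` {..<n} \<subseteq> {..p}"
    and s: "strict_mono_on {..<n} s" "s ` {..<n} \<subseteq> {..p}"
  shows "det (mat n n (\<lambda>(i, j). (1 + e * real (r i * s j + (r i - 2) * (s j - 2))) powr \<alpha>)) \<ge> 0"
proof -
  obtain z :: "nat \<Rightarrow> 'a" where z: "strict_mono_on {..<p + 1} z" "z ` {..<p + 1} \<subseteq> X"
    using exists_strict_mono_into[OF X] by blast
  have "strict_mono_on {..<p + 1} (\<phi> \<circ> z)"
    using z \<phi> by (auto simp: strict_mono_on_def image_subset_iff)
  then have inj: "inj_on (\<phi> \<circ> z) {..<p + 1}" by (rule strict_mono_on_imp_inj_on)
  let ?K = "spline_kernel \<phi> z (p + 1) e"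
  let ?B = "\<lambda>i j. 1 + e * real (i * j + (i - 2) * (j - 2))"
  have rp: "r i < p + 1" "s i < p + 1" if "i < n" for i using r(2) s(2) that by (auto simp: image_subset_iff less_Suc_eq_le)
  have zr: "strict_mono_on {..<n} (z \<circ> r)" "(z \<circ> r) ` {..<n} \<subseteq> X"
    "strict_mono_on {..<n} (z \<circ> s)" "(z \<circ> s) ` {..<n} \<subseteq> X"
    using z r(1) s(1) rp by (auto simp: strict_mono_on_def image_subset_iff)
  have nonneg: "det (mat n n (\<lambda>(i, j). ?K t (z (r i)) (z (s j)) powr \<alpha>)) \<ge> 0" if "t > 0" for t
  proof -
    have K: "TP_kernel X p (?K t)"
      using \<phi> z that e by (intro TP_kernel_spline_kernel) auto
    have "TP_kernel X p (\<lambda>x y. F (?K t x y))" by (intro F symmetric_spline_kernel K)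
    then have "det (mat n n (\<lambda>(i, j). F (?K t ((z \<circ> r) i) ((z \<circ> s) j)))) > 0"
      using zr n unfolding TP_kernel_def by (meson atLeastAtMost_iff)
    \<comment> \<open>The factor 1 fits the shape of \<open>det_scale_rows_cols\<close>:
      \<open>c\<close> scales the rows and 1 the columns.\<close>
    moreover have "F (?K t (z (r i)) (z (s j))) = c * 1 * ?K t (z (r i)) (z (s j)) powr \<alpha>" if "i < n" "j < n" for i j
    proof -
      have "?K t (z (r i)) (z (s j)) > 0"
        using zr that p by (intro TP_kernel_pos[OF K]) (auto simp: image_subset_iff)
      then show ?thesis by (simp add: F_eq)
    qed
    then have "mat n n (\<lambda>(i, j). F (?K t ((z \<circ> r) i) ((z \<circ> s) j))) =
        mat n n (\<lambda>(i, j). c * 1 * ?K t (z (r i)) (z (s j)) powr \<alpha>)"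
      by (intro eq_matI) auto
    ultimately have "(\<Prod>i<n. c) * (\<Prod>i<n. 1) * det (mat n n (\<lambda>(i, j). ?K t (z (r i)) (z (s j)) powr \<alpha>)) > 0"
      by (simp only: det_scale_rows_cols)
    then show ?thesis using c by (simp add: zero_less_mult_iff)
  qed
  have "eventually (\<lambda>t. det (mat n n (\<lambda>(i, j). ?K t (z (r i)) (z (s j)) powr \<alpha>)) \<ge> 0) at_top"
    by (rule eventually_mono[OF eventually_gt_at_top[of 0]]) (rule nonneg)
  moreover have "((\<lambda>t. det (mat n n (\<lambda>(i, j). ?K t (z (r i)) (z (s j)) powr \<alpha>))) \<longlongrightarrow>
      det (mat n n (\<lambda>(i, j). ?B (r i) (s j) powr \<alpha>))) at_top"
  proof (rule tendsto_det)
    fix i j assume "i < n" "j < n"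
    then have "((\<lambda>t. ?K t (z (r i)) (z (s j))) \<longlongrightarrow> ?B (r i) (s j)) at_top"
      using p by (intro tendsto_spline_kernel_nodes[OF inj] rp) auto
    moreover have "?B (r i) (s j) > 0" using e by (intro add_pos_nonneg) auto
    ultimately show "((\<lambda>t. ?K t (z (r i)) (z (s j)) powr \<alpha>) \<longlongrightarrow> ?B (r i) (s j) powr \<alpha>) at_top"
      by (intro tendsto_powr tendsto_const) auto
  qed
  ultimately show ?thesis by (intro tendsto_lowerbound[of _ _ at_top]) auto
qed

text \<open>Differences of neighbouring columns turn the row of ones into
  \<open>(1, 0, 0, 0)\<close>, leaving a 3 by 3 block.\<close>

lemma det_mat_4_ones_row:
  assumes "\<And>j. j < 4 \<Longrightarrow> A 0 j = 1"
  shows "det (mat 4 4 (\<lambda>(i, j). A i j)) =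
    det3 (A 1 1 - A 1 0) (A 1 2 - A 1 1) (A 1 3 - A 1 2)
      (A 2 1 - A 2 0) (A 2 2 - A 2 1) (A 2 3 - A 2 2)
      (A 3 1 - A 3 0) (A 3 2 - A 3 1) (A 3 3 - A 3 2)"
proof -
  have A: "A 0 0 = 1" "A 0 1 = 1" "A 0 2 = 1" "A 0 3 = 1" using assms by auto
  have four: "(4::nat) = Suc 3" by simp
  have expand: "det (mat 4 4 (\<lambda>(i, j). A i j)) =
    det (mat 3 3 (\<lambda>(i, j). A (Suc i) (Suc j)))
    - det (mat 3 3 (\<lambda>(i, k). A (Suc i) (if k < 1 then k else Suc k)))
    + det (mat 3 3 (\<lambda>(i, k). A (Suc i) (if k < 2 then k else Suc k)))
    - det (mat 3 3 (\<lambda>(i, k). A (Suc i) (if k < 3 then k else Suc k)))"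
    unfolding four det_mat_Suc using A by (simp add: numeral_3_eq_3 numeral_2_eq_2)
  show ?thesis
    unfolding expand det_mat_3 det3_def
    by (simp add: numeral_2_eq_2 numeral_3_eq_3 algebra_simps)
qed

lemma TP_preserver_form_if_TP_preserver:
  fixes X :: "'a::linorder set"
  assumes \<phi>: "2 \<le> p \<Longrightarrow> strict_mono_on X (\<phi> :: 'a \<Rightarrow> real)"
    and X: "infinite X \<or> p + 1 \<le> card X" and p: "0 < p"
    and F: "\<And>K. symmetric_kernel X K \<Longrightarrow> TP_kernel X p K \<Longrightarrow> TP_kernel X p (\<lambda>x y. F (K x y))"
  shows "TP_preserver_form p F"
proof (cases "p = 1")
  case True
  obtain x where x: "x \<in> X" using X by fastforce
  have "F t > 0" if "t > 0" for t
  proof -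
    have "det (mat n n (\<lambda>(i, j). t)) > 0" if "n \<in> {1..p}" for n
    proof -
      have "n = 1" using that True by simp
      then show ?thesis using \<open>t > 0\<close> det_mat_1[of "\<lambda>_ _. t"] by simp
    qed
    \<comment> \<open>For \<open>p = 1\<close> positive constant kernels already realize every
      argument of \<open>F\<close>.\<close>
    then have "TP_kernel X p (\<lambda>_ _. t)" by (simp add: TP_kernel_def)
    then have "TP_kernel X p (\<lambda>_ _. F t)" by (intro F) (auto simp: symmetric_kernel_def)
    from TP_kernel_pos[OF this _ x x] p show ?thesis by simp
  qed
  then show ?thesis using True by (simp add: TP_preserver_form_def)
next
  case False
  then have p2: "2 \<le> p" using p by simp
  note \<phi> = \<phi>[OF p2]
  have "infinite X \<or> 3 \<le> card X" using X p2 by auto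
  from power_function_if_TP_preserver[where F=F, OF \<phi> this p2 F]
  obtain c \<alpha> where c: "c > 0" and \<alpha>: "\<alpha> > 0" and F_eq: "\<And>x. x > 0 \<Longrightarrow> F x = c * x powr \<alpha>" by blast
  have minor: "det (mat n n (\<lambda>(i, j). (1 + e * real (r i * s j + (r i - 2) * (s j - 2))) powr \<alpha>)) \<ge> 0"
    if "3 \<le> p" "0 < e" "1 \<le> n" "n \<le> p" "strict_mono_on {..<n} r" "r ` {..<n} \<subseteq> {..p}"
      "strict_mono_on {..<n} s" "s ` {..<n} \<subseteq> {..p}" for e n r s
    by (rule spline_minor_nonneg[where F=F, OF \<phi> X that(1) F c \<alpha> F_eq that(2-)])
  have ge1: "\<alpha> \<ge> 1" if p3: "3 \<le> p"
  proof (rule ccontr)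
    assume "\<not> \<alpha> \<ge> 1"
    then obtain e where e: "e > 0" and
      neg: "((1 + e * 1) powr \<alpha> - 1) * ((1 + e * 4) powr \<alpha> - 1) - ((1 + e * 2) powr \<alpha> - 1)\<^sup>2 < 0"
      using powr_minor3_neg[of \<alpha>] \<alpha> by auto
    \<comment> \<open>On rows and columns 0, 1, 2 the truncated product vanishes and the entries are
      \<open>1 + e * i * j\<close>.\<close>
    have "strict_mono_on {..<3} (\<lambda>i::nat. i)" "(\<lambda>i::nat. i) ` {..<3} \<subseteq> {..p}"
      using p3 by (auto simp: strict_mono_on_def)
    from minor[OF p3 e _ p3 this this]
    have "det (mat 3 3 (\<lambda>(i, j). (1 + e * real (i * j + (i - 2) * (j - 2))) powr \<alpha>)) \<ge> 0"
      by simp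
    then show False using neg unfolding det_mat_3 by (simp add: power2_eq_square left_diff_distrib right_diff_distrib)
  qed
  have eq1: "\<alpha> = 1" if p4: "4 \<le> p"
  proof (rule ccontr)
    assume "\<alpha> \<noteq> 1"
    then have "\<alpha> > 1" using ge1 p4 by simp
    then obtain e where e: "e > 0" and
      neg: "let f = (\<lambda>t. (1 + e * t) powr \<alpha>) in
        det3 (f 2 - f 1) (f 3 - f 2) (f 4 - f 3) (f 4 - f 2) (f 6 - f 4) (f 8 - f 6)
             (f 6 - f 3) (f 10 - f 6) (f 14 - f 10) < 0"
      by (rule powr_minor4_neg)
    have p3: "3 \<le> p" using p4 by simp
    \<comment> \<open>Below a row of ones, columns 1 to 4 give the arguments
      \<open>(1, 2, 3, 4)\<close>, \<open>(2, 4, 6, 8)\<close>, \<open>(3, 6, 10, 14)\<close> of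
      \<open>f\<close>. Node 4 exists because \<open>4 \<le> p\<close>.\<close>
    have "strict_mono_on {..<4} (\<lambda>i::nat. i)" "(\<lambda>i::nat. i) ` {..<4} \<subseteq> {..p}"
      "strict_mono_on {..<4} Suc" "Suc ` {..<4} \<subseteq> {..p}"
      using p4 by (auto simp: strict_mono_on_def)
    from minor[OF p3 e _ p4 this]
    have "det (mat 4 4 (\<lambda>(i, j). (1 + e * real (i * Suc j + (i - 2) * (Suc j - 2))) powr \<alpha>)) \<ge> 0"
      by simp
    then show False using neg by (subst (asm) det_mat_4_ones_row) (simp_all add: Let_def)
  qed
  show ?thesis
    unfolding TP_preserver_form_def
  proof (intro conjI impI)
    assume "p = 1" then show "\<forall>x>0. F x > 0" using False by simp
  next
    show "\<exists>c>0. \<exists>\<alpha>>0. \<forall>x>0. F x = c * x powr \<alpha>" using c \<alpha> F_eq by blast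
  next
    assume "p = 3"
    then show "\<exists>c>0. \<exists>\<alpha>\<ge>1. \<forall>x>0. F x = c * x powr \<alpha>" using c ge1 F_eq by auto
  next
    assume "4 \<le> p"
    then have "F x = c * x" if "x > 0" for x using F_eq[OF that] eq1 that by simp
    then show "\<exists>c>0. \<forall>x>0. F x = c * x" using c by blast
  qed
qed

section \<open>Translation to matrices and the equivalences\<close>

lemma TP_mat_map_mat_iff:
  assumes "A \<in> carrier_mat d d"
  shows "TP_mat p (map_mat F A) \<longleftrightarrow> TP_kernel {..<d} p (\<lambda>i j. F (A $$ (i, j)))"
  using assms by (subst TP_mat_iff_TP_kernel[of _ d]) (auto intro!: TP_kernel_cong)

theorem theorem4p12:
  fixes F :: "real \<Rightarrow> real" and p d :: nat
  assumes "0 < p" and "p < d"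
  shows
    "((\<forall>A\<in>carrier_mat d d. transpose_mat A = A \<longrightarrow> TP_mat p A \<longrightarrow> TP_mat p (map_mat F A))
        \<longleftrightarrow> (\<forall>A\<in>carrier_mat d d. TP_mat p A \<longrightarrow> TP_mat p (map_mat F A)))
     \<and> ((\<forall>A\<in>carrier_mat d d. TP_mat p A \<longrightarrow> TP_mat p (map_mat F A))
        \<longleftrightarrow> (\<forall>A\<in>carrier_mat p p. totally_positive_mat A \<longrightarrow> totally_positive_mat (map_mat F A)))
     \<and> ((\<forall>A\<in>carrier_mat p p. totally_positive_mat A \<longrightarrow> totally_positive_mat (map_mat F A))
        \<longleftrightarrow> TP_preserver_form p F)
     \<and> (\<forall>X :: 'a::linorder set.
          (infinite X \<or> p + 1 \<le> card X) \<longrightarrow>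
          (2 \<le> p \<longrightarrow> (\<exists>K. totally_positive_kernel X K)) \<longrightarrow>
          ((\<forall>K. symmetric_kernel X K \<longrightarrow> TP_kernel X p K \<longrightarrow> TP_kernel X p (\<lambda>x y. F (K x y)))
             \<longleftrightarrow> TP_preserver_form p F))"
    (is "(?sym \<longleftrightarrow> ?all) \<and> (_ \<longleftrightarrow> ?square) \<and> (_ \<longleftrightarrow> ?form) \<and> ?kernel")
proof -
  have form_imp: "TP_mat p (map_mat F A)"
    if ?form "A \<in> carrier_mat n n" "TP_mat p A" for A n
    using TP_kernel_preserved[OF _ \<open>0 < p\<close> that(1)] that(3)
    by (simp only: TP_mat_map_mat_iff[OF that(2)] TP_mat_iff_TP_kernel[OF that(2)])
  \<comment> \<open>Symmetric matrices of size \<open>d\<close> are symmetric kernels on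
    \<open>{..<d}\<close>, embedded by \<open>real\<close>; \<open>p < d\<close> provides the
    \<open>p + 1\<close> points.\<close>
  have sym_imp: ?form if ?sym
  proof (rule TP_preserver_form_if_TP_preserver[where X="{..<d}" and \<phi>=real])
    fix K :: "nat \<Rightarrow> nat \<Rightarrow> real"
    assume sym: "symmetric_kernel {..<d} K" and K: "TP_kernel {..<d} p K"
    let ?A = "mat d d (\<lambda>(i, j). K i j)"
    have A: "?A \<in> carrier_mat d d" by simp
    have "TP_kernel {..<d} p (\<lambda>i j. ?A $$ (i, j)) \<longleftrightarrow> TP_kernel {..<d} p K"
      by (rule TP_kernel_cong) auto
    then have "TP_mat p ?A" using K by (simp add: TP_mat_iff_TP_kernel[OF A])
    moreover have "transpose_mat ?A = ?A"
      using sym by (intro eq_matI) (auto simp: symmetric_kernel_def)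
    ultimately have "TP_mat p (map_mat F ?A)" using that A by blast
    then have "TP_kernel {..<d} p (\<lambda>i j. F (?A $$ (i, j)))" by (simp only: TP_mat_map_mat_iff[OF A])
    moreover have "TP_kernel {..<d} p (\<lambda>i j. F (?A $$ (i, j))) \<longleftrightarrow> TP_kernel {..<d} p (\<lambda>i j. F (K i j))"
      by (rule TP_kernel_cong) auto
    ultimately show "TP_kernel {..<d} p (\<lambda>i j. F (K i j))" by blast
  qed (use assms in \<open>auto simp: strict_mono_on_def\<close>)
  have square_imp: ?all if ?square
  proof (intro ballI impI)
    fix A :: "real mat" assume A: "A \<in> carrier_mat d d" and "TP_mat p A"
    then have K: "TP_kernel {..<d} p (\<lambda>i j. A $$ (i, j))" by (simp only: TP_mat_iff_TP_kernel)
    have "TP_kernel {..<d} p (\<lambda>i j. F (A $$ (i, j)))"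
    proof (rule TP_kernel_preserved_if_square_preserved[OF _ K])
      show "totally_positive_mat (map_mat F B)" if "B \<in> carrier_mat p p" "totally_positive_mat B" for B
        using that \<open>?square\<close> by blast
    qed (use \<open>p < d\<close> in simp)
    then show "TP_mat p (map_mat F A)" by (simp only: TP_mat_map_mat_iff[OF A])
  qed
  have form_square: ?square if ?form
    using form_imp[OF that] totally_positive_mat_iff_TP_mat map_carrier_mat by metis
  have ?kernel
  proof (intro allI impI)
    fix X :: "'a set"
    assume X: "infinite X \<or> p + 1 \<le> card X" and ex: "2 \<le> p \<longrightarrow> (\<exists>K. totally_positive_kernel X K)"
    \<comment> \<open>The embedding is extracted from the 2 by 2 minors of the given kernel; for
      \<open>p = 1\<close> nothing has to be embedded.\<close>
    obtain \<phi> :: "'a \<Rightarrow> real" where \<phi>: "2 \<le> p \<Longrightarrow> strict_mono_on X \<phi>"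
    proof (cases "2 \<le> p")
      case True
      then obtain K :: "'a \<Rightarrow> 'a \<Rightarrow> real" where "TP_kernel X 2 K"
        using ex by (auto simp: totally_positive_kernel_def)
      moreover have "infinite X \<or> 2 \<le> card X" using X True by auto
      ultimately show thesis using TP_kernel_imp_order_embedding[of X 2 K] that by blast
    qed (use that in blast)
    show "(\<forall>K. symmetric_kernel X K \<longrightarrow> TP_kernel X p K \<longrightarrow> TP_kernel X p (\<lambda>x y. F (K x y))) \<longleftrightarrow> ?form"
      using TP_preserver_form_if_TP_preserver[OF \<phi> X \<open>0 < p\<close>, of F] TP_kernel_preserved[OF _ \<open>0 < p\<close>, of X _ F]
      by blast
  qed
  moreover have "?all \<Longrightarrow> ?sym" by blast
  \<comment> \<open>The matrix conditions close up in a cycle: \<open>?form\<close>,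
    \<open>?square\<close>, \<open>?all\<close>, \<open>?sym\<close>, \<open>?form\<close>.\<close>
  ultimately show ?thesis using form_imp sym_imp square_imp form_square by blast
qed

end
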